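(* Let $a\ge b\ge c>0$ be real numbers, and consider the hemiellipsoid $$x=a\left(1-\frac{y^2}{b^2}-\frac{z^2}{c^2}\right)^{1/2}$$ (whose axis is the positive direction of the $x$-axis) lying above the $y$-$z$ plane (i.e. $x=0$). Case I. If $a>b$ and $\left|1-\frac{a^2}{b^2}\right|<1$ (i.e. $0<\frac{a^2}{b^2}<2$), then the curved surface area of the hemiellipsoid is $$\hat S_2=\frac{2\pi a^2c^2}{b^2}\;F_1\left[2;\,\tfrac12,\,\tfrac12;\,\tfrac32;\;1-\frac{c^2}{b^2},\;1-\frac{a^2}{b^2}\right],$$ where $\left|1-\frac{a^2}{b^2}\right|<1$ and $\left|1-\frac{c^2}{b^2}\right|<1$ (i.e. $0<\frac{c^2}{b^2}<2$). Case II. If $a>b$ and $\left|1-\frac{a^2}{b^2}\right|>1$ (i.e. $2<\frac{a^2}{b^2}<\infty$), then the curved surface area of the hemiellipsoid is $$\hat S_3=\frac{\pi^2a^2c^2}{2b\sqrt{a^2-b^2}}\;F_1\left[\tfrac12;\,\tfrac32,\,\tfrac12;\,1;\;\frac{b^2-c^2}{b^2},\;\frac{b^2-c^2}{b^2-a^2}\right]-\frac{2\pi a^2b^2c^2}{3(a^2-b^2)^2}\;F_1\left[2;\,\tfrac32,\,\tfrac12;\,\tfrac52;\;\frac{b^2}{b^2-a^2},\;\frac{b^2-c^2}{b^2-a^2}\right],$$ where $\left|1-\frac{c^2}{b^2}\right|<1$ (i.e. $0<\frac{c^2}{b^2}<2$), $\left|1-\frac{a^2}{b^2}\right|>1$ (equivalently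 $\left|\frac{b^2}{b^2-a^2}\right|<1$, i.e. $2<\frac{a^2}{b^2}<\infty$), and $\left|\frac{b^2-c^2}{b^2-a^2}\right|<1$.
   Context: The curved surface area of a surface $x=g(y,z)$ whose projection on the $y$-$z$ plane is a region $D$ is $\hat S=\iint_{D}\sqrt{1+\left(\frac{\partial x}{\partial y}\right)^2+\left(\frac{\partial x}{\partial z}\right)^2}\,dy\,dz$ (the flat base is not counted); here $D$ is the elliptical region $\frac{y^2}{b^2}+\frac{z^2}{c^2}\le 1$, the integrand being defined in its interior. Appell's function of the first kind is $$F_1[\alpha;\beta,\gamma;\delta;x,y]=\sum_{m,n=0}^{\infty}\frac{(\alpha)_{m+n}(\beta)_m(\gamma)_n}{(\delta)_{m+n}\,m!\,n!}x^m y^n,\qquad |x|<1,\ |y|<1,$$ where $(\alpha)_0=1$ and $(\alpha)_n=\alpha(\alpha+1)\cdots(\alpha+n-1)$ for $n\ge1$. *)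

theory Defs
  imports "HOL-Analysis.Analysis"
begin

(* Unordered double series; for real terms this is absolute convergence. In the region
   of definition |x| < 1, |y| < 1 the series converges absolutely unless delta is a
   non-positive integer. *)
definition appell_F1 :: "real \<Rightarrow> real \<Rightarrow> real \<Rightarrow> real \<Rightarrow> real \<Rightarrow> real \<Rightarrow> real" where
  "appell_F1 \<alpha> \<beta> \<gamma> \<delta> x y =
     (\<Sum>\<^sub>\<infinity>(m, n)\<in>(UNIV :: (nat \<times> nat) set).
        pochhammer \<alpha> (m + n) * pochhammer \<beta> m * pochhammer \<gamma> n
          / (pochhammer \<delta> (m + n) * fact m * fact n) * x ^ m * y ^ n)"

(* The integral is over the interior of D only: on the boundary the partial derivatives
   of the graph function need not exist (for the hemiellipsoid they are unbounded there). *)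
definition curved_surface_area :: "(real \<Rightarrow> real \<Rightarrow> real) \<Rightarrow> (real \<times> real) set \<Rightarrow> real" where
  "curved_surface_area g D =
     (LINT (y, z) : interior D | lborel.
        sqrt (1 + (deriv (\<lambda>t. g t z) y)\<^sup>2 + (deriv (\<lambda>t. g y t) z)\<^sup>2))"

definition elliptical_region :: "real \<Rightarrow> real \<Rightarrow> (real \<times> real) set" where
  "elliptical_region b c = {(y, z). y\<^sup>2 / b\<^sup>2 + z\<^sup>2 / c\<^sup>2 \<le> 1}"

definition hemiellipsoid :: "real \<Rightarrow> real \<Rightarrow> real \<Rightarrow> real \<Rightarrow> real \<Rightarrow> real" where
  "hemiellipsoid a b c y z = a * sqrt (1 - y\<^sup>2 / b\<^sup>2 - z\<^sup>2 / c\<^sup>2)"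

end

(* In terms of the slope w = tan \<phi> of the unit normal in the base plane and its height t, the area element
   becomes (abc)^2 / h^4 times the spherical area element, where h is the support function
   (the parametrisation by the Gauss map):
     S = 2 a^2 b^2 c^2 \<integral>_R dw / (1 + w^2) \<integral>_0^1 dt / (B (1 - t^2) + a^2 t^2)^2,
     B = b^2 - (b^2 - c^2) sin^2 \<phi>.
   Expanding the inverse square as a double binomial series around b^2 and integrating termwise
   gives Case I.  In Case II the series around b^2 diverges; instead \<integral>_0^1 dt is written as
   \<integral>_0^\<infinity> dt - \<integral>_1^\<infinity> dt.  The first integral is elementary in t and leaves an Euler-type integral
   for F_1[1/2; 3/2, 1/2; 1], the second becomes, after t = 1/s, an inverse square that is expanded
   around a^2 - b^2. *)

theory Submission
  imports Defs "HOL-Probability.Sinc_Integral" "HOL-Real_Asymp.Real_Asymp"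
begin

subsection \<open>Moments of the height and slope measures\<close>

text \<open>Working with w = tan \<phi> instead of \<phi> makes the change of the second base
  coordinate linear for fixed y, and turns d\<phi> into a finite measure of mass pi on the whole
  line. The height t of the unit normal is the reciprocal of the area element of the graph, so
  taking it as a variable removes the blow-up of the gradient at the rim and leaves a bounded
  rational integrand. Up to a constant this integrand is the inverse square of 1 - X t^2 - y (1 -
  t^2) sin^2 \<phi>. Its expansion supplies (2)_(m+n); the Wallis and beta integrals of the
  monomials supply the remaining Pochhammer symbols. Because t^2 and 1 - t^2 are convex weights, |X|
  < 1 and |y| < 1 separately give uniform absolute convergence, with no condition on |X| + |y|. In
  Case II the offending parameter is X = 1 - a^2 / b^2. The inversion t = 1/s swaps the two
  coefficients of the quadratic P + Q t^2 and thereby replaces X by its reciprocal b^2 / (b^2 -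
  a^2).\<close>

definition slope_measure :: "real measure" where
  "slope_measure = density lborel (\<lambda>w. ennreal (inverse (1 + w\<^sup>2)))"

definition height_measure :: "real measure" where
  "height_measure = restrict_space lborel {0..1}"

definition sin2_of_slope :: "real \<Rightarrow> real" where
  "sin2_of_slope w = w\<^sup>2 / (1 + w\<^sup>2)"

lemma sin2_of_slope_bounds: "0 \<le> sin2_of_slope w" "sin2_of_slope w \<le> 1"
  by (auto simp: sin2_of_slope_def add_pos_nonneg)

lemma sin2_of_slope_measurable [measurable]: "sin2_of_slope \<in> borel_measurable borel"
  unfolding sin2_of_slope_def by measurable

lemma sets_slope_measure [measurable_cong, simp]: "sets slope_measure = sets borel"
  and space_slope_measure [simp]: "space slope_measure = UNIV"
  by (simp_all add: slope_measure_def)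

lemma sets_height_measure [measurable_cong]: "sets height_measure = sets (restrict_space borel {0..1})"
  and space_height_measure [simp]: "space height_measure = {0..1}"
  by (auto simp: height_measure_def space_restrict_space sets_restrict_space)

lemma finite_slope_measure: "finite_measure slope_measure"
proof (rule finite_measureI)
  have "integrable lborel (\<lambda>w::real. inverse (1 + w\<^sup>2))"
    using integrable_inverse_1_plus_square by (simp add: set_integrable_def)
  hence "(\<integral>\<^sup>+w. ennreal (inverse (1 + w\<^sup>2)) \<partial>(lborel :: real measure)) < \<infinity>"
    by (subst nn_integral_eq_integral) auto
  thus "emeasure slope_measure (space slope_measure) \<noteq> \<infinity>"
    by (simp add: slope_measure_def emeasure_density)
qed

lemma finite_height_measure: "finite_measure height_measure"
  by (rule finite_measureI) (simp add: height_measure_def space_restrict_space emeasure_restrict_space)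

lemma integrable_slope_measure_bounded:
  fixes f :: "real \<Rightarrow> real"
  assumes "f \<in> borel_measurable borel" "\<And>w. \<bar>f w\<bar> \<le> C"
  shows "integrable slope_measure f"
  using assms by (intro finite_measure.integrable_const_bound[OF finite_slope_measure, of _ C])
     (auto simp: slope_measure_def)

lemma integral_slope_measure:
  fixes f :: "real \<Rightarrow> real"
  assumes "f \<in> borel_measurable borel"
  shows "(\<integral>w. f w \<partial>slope_measure) = (\<integral>w. f w / (1 + w\<^sup>2) \<partial>lborel)"
  unfolding slope_measure_def using assms
  by (subst integral_density) (auto simp: field_simps)

text \<open>These are the Wallis integrals of sin^(2n) \<phi> over (-pi/2, pi/2). The reduction
  formula comes from integrating an exact derivative over the whole line.\<close>

lemma integral_sin2_of_slope_power:
  "(\<integral>w. sin2_of_slope w ^ n \<partial>slope_measure) = pi * pochhammer (1/2) n / fact n"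
proof (induction n)
  case 0
  have "(\<integral>w. inverse (1 + w\<^sup>2) \<partial>(lborel :: real measure)) = pi"
    using LBINT_inverse_1_plus_square
    by (simp add: interval_lebesgue_integral_def set_lebesgue_integral_def)
  thus ?case by (subst integral_slope_measure) (auto simp: field_simps)
next
  case (Suc n)
  let ?s = sin2_of_slope
  have int: "integrable slope_measure (\<lambda>w. ?s w ^ k)" for k
    by (rule integrable_slope_measure_bounded[of _ 1]) (auto simp: sin2_of_slope_bounds power_le_one)
  \<comment> \<open>\<open>F\<close> below is sin^(2n+1) \<phi> * cos \<phi> written in w, and
    \<open>h\<close> is its derivative. The coefficients 2n + 1 and 2n + 2 come from replacing cos^2
    \<phi> by 1 - sin^2 \<phi>.\<close>
  define h where "h = (\<lambda>w::real. ((2 * n + 1) * ?s w ^ n - (2 * n + 2) * ?s w ^ Suc n) / (1 + w\<^sup>2))"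
  define F where "F = (\<lambda>w::real. ?s w ^ n * (w / (1 + w\<^sup>2)))"
  have F_deriv: "(F has_vector_derivative h w) (at w)" for w
  proof -
    have pos: "1 + w\<^sup>2 > 0" by (simp add: add_pos_nonneg)
    have s_deriv: "(?s has_field_derivative 2 * w / (1 + w\<^sup>2)\<^sup>2) (at w)"
      unfolding sin2_of_slope_def
      by (rule derivative_eq_intros refl | use pos in \<open>simp add: field_simps power2_eq_square\<close>)+
    have "((\<lambda>w. w / (1 + w\<^sup>2)) has_field_derivative (1 - w\<^sup>2) / (1 + w\<^sup>2)\<^sup>2) (at w)"
      by (rule derivative_eq_intros refl | use pos in \<open>simp add: field_simps power2_eq_square\<close>)+
    from DERIV_mult[OF DERIV_power[OF s_deriv, of n] this]
    have "(F has_field_derivative (n * ?s w ^ (n - 1) * (2 * w / (1 + w\<^sup>2)\<^sup>2)) * (w / (1 + w\<^sup>2))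
             + ?s w ^ n * ((1 - w\<^sup>2) / (1 + w\<^sup>2)\<^sup>2)) (at w)"
      unfolding F_def by (simp add: mult_ac)
    also have "(n * ?s w ^ (n - 1) * (2 * w / (1 + w\<^sup>2)\<^sup>2)) * (w / (1 + w\<^sup>2))
             = 2 * n * ?s w ^ n / (1 + w\<^sup>2)\<^sup>2"
      by (cases n) (use pos in \<open>auto simp: sin2_of_slope_def power2_eq_square field_simps\<close>)
    also have "2 * n * ?s w ^ n / (1 + w\<^sup>2)\<^sup>2 + ?s w ^ n * ((1 - w\<^sup>2) / (1 + w\<^sup>2)\<^sup>2) = h w"
    proof -
      have "(2 * n + 1) - (2 * n + 2) * ?s w = (2 * n + 1 - w\<^sup>2) / (1 + w\<^sup>2)"
        using pos by (simp add: sin2_of_slope_def field_simps)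
      moreover have "h w = ?s w ^ n * ((2 * n + 1) - (2 * n + 2) * ?s w) / (1 + w\<^sup>2)"
        by (simp add: h_def algebra_simps)
      ultimately have "h w = ?s w ^ n * ((2 * n + 1 - w\<^sup>2) / (1 + w\<^sup>2)) / (1 + w\<^sup>2)"
        by (simp only:)
      moreover have "2 * n * S / d\<^sup>2 + S * ((1 - x) / d\<^sup>2) = S * ((2 * n + 1 - x) / d) / d" for S d x :: real
        by (simp add: power2_eq_square add_divide_distrib diff_divide_distrib algebra_simps)
      ultimately show ?thesis by simp
    qed
    finally show ?thesis by (simp add: has_real_derivative_iff_has_vector_derivative)
  qed
  have "integrable slope_measure (\<lambda>w. (2 * n + 1) * ?s w ^ n - (2 * n + 2) * ?s w ^ Suc n)"
    by (intro Bochner_Integration.integrable_diff integrable_mult_right int)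
  hence h_int: "integrable lborel h"
    unfolding slope_measure_def h_def
    by (subst (asm) integrable_density) (auto simp: field_simps)
  \<comment> \<open>The power of \<open>sin2_of_slope\<close> is at most 1, so the factor w / (1 +
    w^2) alone forces both boundary terms to vanish.\<close>
  have lim: "(F \<longlongrightarrow> 0) G" if "((\<lambda>w::real. w / (1 + w\<^sup>2)) \<longlongrightarrow> 0) G" for G
    by (rule Lim_null_comparison[OF _ tendsto_rabs_zero[OF that]])
       (auto intro!: always_eventually divide_right_mono mult_left_le_one_le
             simp: F_def abs_mult sin2_of_slope_bounds power_le_one power_abs)
  have "((\<lambda>w::real. w / (1 + w\<^sup>2)) \<longlongrightarrow> 0) at_top" "((\<lambda>w::real. w / (1 + w\<^sup>2)) \<longlongrightarrow> 0) at_bot"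
    by real_asymp+
  hence "(LBINT w=-\<infinity>..\<infinity>. h w) = 0 - 0"
    using h_int F_deriv
    by (intro interval_integral_FTC_integrable[where F=F])
       (auto simp: set_integrable_def h_def sin2_of_slope_def ereal_tendsto_simps add_nonneg_eq_0_iff intro!: lim continuous_intros)
  hence "0 = (\<integral>w. h w \<partial>lborel)"
    by (simp add: interval_lebesgue_integral_def set_lebesgue_integral_def)
  also have "\<dots> = (\<integral>w. (2 * n + 1) * ?s w ^ n - (2 * n + 2) * ?s w ^ Suc n \<partial>slope_measure)"
    by (subst integral_slope_measure) (auto simp: h_def)
  also have "\<dots> = (2 * n + 1) * (\<integral>w. ?s w ^ n \<partial>slope_measure) - (2 * n + 2) * (\<integral>w. ?s w ^ Suc n \<partial>slope_measure)"
    by (subst Bochner_Integration.integral_diff) (auto simp del: power_Suc intro!: int integrable_mult_right)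
  finally have eq: "0 = (2 * n + 1) * (pi * pochhammer (1/2) n / fact n)
      - (2 * n + 2) * (\<integral>w. ?s w ^ Suc n \<partial>slope_measure)"
    unfolding Suc .
  have "x = A / (2 * n + 2)" if "0 = A - (2 * n + 2) * x" for x A :: real
    using that by (simp add: field_simps)
  from this[OF eq]
  have "(\<integral>w. ?s w ^ Suc n \<partial>slope_measure) = (2 * n + 1) * (pi * pochhammer (1/2) n / fact n) / (2 * n + 2)" .
  also have "\<dots> = pi * pochhammer (1/2) (Suc n) / fact (Suc n)"
    by (simp add: pochhammer_Suc divide_simps)
  finally show ?case .
qed

section \<open>Beta integrals over the unit interval\<close>

lemma integral_height_measure:
  fixes f :: "real \<Rightarrow> real"
  shows "(\<integral>t. f t \<partial>height_measure) = (\<integral>t. f t * indicator {0..1} t \<partial>lborel)"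
  unfolding height_measure_def by (subst integral_restrict_space) (auto simp: mult.commute)

lemma integrable_height_measure_bounded:
  fixes f :: "real \<Rightarrow> real"
  assumes "f \<in> borel_measurable borel" "\<And>t. t \<in> {0..1} \<Longrightarrow> \<bar>f t\<bar> \<le> C"
  shows "integrable height_measure f"
  using assms by (intro finite_measure.integrable_const_bound[OF finite_height_measure, of _ C])
     (auto simp: height_measure_def space_restrict_space intro: measurable_restrict_space1)

text \<open>Half the beta function at k + 1/2 and n + 1, by u = t^2. Splitting off one factor 1 -
  t^2 gives the difference of the values at k and k + 1, so \<open>k\<close> has to vary in the
  induction.\<close>

lemma integral_height_measure_beta:
  "(\<integral>t. t ^ (2 * k) * (1 - t\<^sup>2) ^ n \<partial>height_measure) = fact n / (2 * pochhammer (k + 1/2) (Suc n))"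
proof (induction n arbitrary: k)
  case 0
  have "(\<integral>t. t ^ (2 * k) \<partial>height_measure) = 1 / (2 * k + 1)"
    unfolding integral_height_measure using integral_power[of 0 1 "2 * k"]
    by simp
  thus ?case by (simp add: field_simps)
next
  case (Suc n)
  have int: "integrable height_measure (\<lambda>t. t ^ (2 * k) * (1 - t\<^sup>2) ^ n)" for k n
    by (rule integrable_height_measure_bounded[of _ 1])
       (auto intro!: mult_le_one power_le_one simp: abs_mult power_le_one_iff)
  have "(\<integral>t. t ^ (2 * k) * (1 - t\<^sup>2) ^ Suc n \<partial>height_measure)
     = (\<integral>t. t ^ (2 * k) * (1 - t\<^sup>2) ^ n - t ^ (2 * Suc k) * (1 - t\<^sup>2) ^ n \<partial>height_measure)"
    by (rule Bochner_Integration.integral_cong) (auto simp: algebra_simps power2_eq_square)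
  also have "\<dots> = fact n / (2 * pochhammer (k + 1/2) (Suc n)) - fact n / (2 * pochhammer (Suc k + 1/2) (Suc n))"
    by (subst Bochner_Integration.integral_diff) (auto simp only: int Suc)
  also have "\<dots> = fact (Suc n) / (2 * pochhammer (k + 1/2) (Suc (Suc n)))"
  proof -
    \<comment> \<open>Both fractions contain \<open>P\<close>; what remains is 1/z - 1/(z + 1 + n),
      whose numerator n + 1 completes the factorial.\<close>
    define z where "z = real k + 1/2"
    have z: "z > 0" "real (Suc k) + 1/2 = z + 1" by (simp_all add: z_def)
    define P where "P = pochhammer (z + 1) n"
    have "P > 0" unfolding P_def using z by (intro pochhammer_pos) auto
    have 1: "pochhammer z (Suc n) = z * P" "pochhammer (z + 1) (Suc n) = P * (z + 1 + n)"
      unfolding P_def by (rule pochhammer_rec) (simp add: pochhammer_Suc)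
    have 2: "pochhammer z (Suc (Suc n)) = z * P * (z + 1 + n)"
      by (subst pochhammer_rec) (simp add: 1)
    show ?thesis
      unfolding z(2) z_def[symmetric] 1 2 using z(1) \<open>P > 0\<close>
      by (simp add: divide_simps) (simp add: algebra_simps)
  qed
  finally show ?case .
qed

subsection \<open>Double binomial series\<close>

text \<open>Dominated convergence for unordered double series: on a finite measure space the
  constant \<open>C\<close> is an integrable majorant of every partial sum, and it also makes the
  series of integrals absolutely summable.\<close>

lemma has_sum_integral_bounded:
  fixes \<phi> :: "nat \<times> nat \<Rightarrow> 'a \<Rightarrow> real"
  assumes fin: "finite_measure M"
  assumes [measurable]: "\<And>k. \<phi> k \<in> borel_measurable M"
  assumes sum: "\<And>x. x \<in> space M \<Longrightarrow> ((\<lambda>k. \<phi> k x) has_sum f x) UNIV"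
  assumes bound: "\<And>x S. x \<in> space M \<Longrightarrow> finite S \<Longrightarrow> (\<Sum>k\<in>S. \<bar>\<phi> k x\<bar>) \<le> C"
  shows "((\<lambda>k. \<integral>x. \<phi> k x \<partial>M) has_sum (\<integral>x. f x \<partial>M)) UNIV" (is ?sum)
    and "integrable M f"
proof -
  interpret finite_measure M by fact
  have int: "integrable M (\<phi> k)" for k
    using bound[of _ "{k}"] by (intro integrable_const_bound[of _ C]) auto
  let ?I = "\<lambda>k. \<integral>x. \<phi> k x \<partial>M"
  have "(\<Sum>k\<in>S. \<bar>?I k\<bar>) \<le> C * measure M (space M)" if "finite S" for S
  proof -
    have "(\<Sum>k\<in>S. \<bar>?I k\<bar>) \<le> (\<Sum>k\<in>S. \<integral>x. \<bar>\<phi> k x\<bar> \<partial>M)"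
      by (intro sum_mono integral_abs_bound)
    also have "\<dots> = (\<integral>x. (\<Sum>k\<in>S. \<bar>\<phi> k x\<bar>) \<partial>M)"
      using int by (subst Bochner_Integration.integral_sum) auto
    also have "\<dots> \<le> (\<integral>x. C \<partial>M)"
      using int bound that by (intro integral_mono) auto
    finally show ?thesis by (simp add: mult.commute)
  qed
  hence "(\<lambda>k. \<bar>?I k\<bar>) summable_on UNIV"
    by (intro nonneg_bdd_above_summable_on bdd_aboveI[of _ "C * measure M (space M)"]) auto
  hence "?I summable_on UNIV"
    using abs_summable_summable[of ?I UNIV] by simp
  then obtain L where L: "(?I has_sum L) UNIV"
    by (auto simp: summable_on_def)
  \<comment> \<open>The dominated convergence theorem speaks of sequences, so the pairs are
    enumerated by \<open>prod_decode\<close>. An unordered sum has the same value along any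
    enumeration, which identifies \<open>L\<close>.\<close>
  have seq: "(\<lambda>N. \<Sum>i<N. g (prod_decode i)) \<longlonglongrightarrow> l" if "(g has_sum l) UNIV" for g l
  proof -
    have "((\<lambda>i. g (prod_decode i)) has_sum l) UNIV"
      using that has_sum_reindex_bij_betw[OF bij_prod_decode, of g l] by simp
    thus ?thesis using has_sum_imp_sums by (auto simp: sums_def)
  qed
  let ?s = "\<lambda>N x. \<Sum>i<N. \<phi> (prod_decode i) x"
  have s_bound: "\<bar>?s N x\<bar> \<le> C" if "x \<in> space M" for N x
  proof -
    have "\<bar>?s N x\<bar> \<le> (\<Sum>i<N. \<bar>\<phi> (prod_decode i) x\<bar>)" by (rule sum_abs)
    also have "\<dots> = (\<Sum>k\<in>prod_decode ` {..<N}. \<bar>\<phi> k x\<bar>)"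
      by (subst sum.reindex) (auto simp: inj_prod_decode)
    finally show ?thesis using bound[OF that, of "prod_decode ` {..<N}"] by simp
  qed
  have lim: "(\<lambda>N. ?s N x) \<longlonglongrightarrow> f x" if "x \<in> space M" for x
    using seq[OF sum[OF that]] .
  have [measurable]: "f \<in> borel_measurable M"
    by (rule borel_measurable_LIMSEQ_real[OF lim]) auto
  show "integrable M f"
  proof (rule integrable_const_bound[of _ C])
    have "\<bar>f x\<bar> \<le> C" if "x \<in> space M" for x
      using LIMSEQ_le_const2[OF tendsto_rabs[OF lim[OF that]]] s_bound[OF that] by blast
    thus "AE x in M. norm (f x) \<le> C" by auto
  qed auto
  have "(\<lambda>N. \<integral>x. ?s N x \<partial>M) \<longlonglongrightarrow> (\<integral>x. f x \<partial>M)"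
    by (rule integral_dominated_convergence[where w = "\<lambda>_. C"])
       (use lim s_bound in \<open>auto intro!: AE_I2\<close>)
  also have "(\<lambda>N. \<integral>x. ?s N x \<partial>M) = (\<lambda>N. \<Sum>i<N. ?I (prod_decode i))"
    using int by (subst Bochner_Integration.integral_sum) auto
  finally have "L = (\<integral>x. f x \<partial>M)"
    using LIMSEQ_unique seq[OF L] by blast
  thus ?sum using L by simp
qed

text \<open>For \<beta> > 0 the coefficients are nonnegative, so the series of absolute values is
  the same series at |x|. This second sum is the source of all uniform majorants below.\<close>

lemma binomial_series_has_sum:
  fixes x \<beta> :: real
  assumes "\<bar>x\<bar> < 1" "\<beta> > 0"
  shows "((\<lambda>n. pochhammer \<beta> n / fact n * x ^ n) has_sum (1 - x) powr (-\<beta>)) UNIV"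
    and "((\<lambda>n. \<bar>pochhammer \<beta> n / fact n * x ^ n\<bar>) has_sum (1 - \<bar>x\<bar>) powr (-\<beta>)) UNIV"
proof -
  have *: "(\<lambda>n. pochhammer \<beta> n / fact n * y ^ n) sums (1 - y) powr (-\<beta>)" if "\<bar>y\<bar> < 1" for y
  proof -
    have "(-\<beta> gchoose n) * (-y) ^ n = pochhammer \<beta> n / fact n * y ^ n" for n
    proof -
      have "(-1) ^ n * (-y) ^ n = y ^ n" by (simp flip: power_mult_distrib)
      thus ?thesis by (simp add: gbinomial_pochhammer mult_ac)
    qed
    thus ?thesis using gen_binomial_real[of "-y" "-\<beta>"] that by simp
  qed
  have poch: "pochhammer \<beta> n \<ge> 0" for n
    using assms(2) by (intro pochhammer_nonneg) auto
  have abs: "\<bar>pochhammer \<beta> n / fact n * x ^ n\<bar> = pochhammer \<beta> n / fact n * \<bar>x\<bar> ^ n" for n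
    using poch[of n] by (simp add: abs_mult power_abs)
  show abs_sum: "((\<lambda>n. \<bar>pochhammer \<beta> n / fact n * x ^ n\<bar>) has_sum (1 - \<bar>x\<bar>) powr (-\<beta>)) UNIV"
    unfolding abs using *[of "\<bar>x\<bar>"] assms(1) poch by (intro sums_nonneg_imp_has_sum) auto
  show "((\<lambda>n. pochhammer \<beta> n / fact n * x ^ n) has_sum (1 - x) powr (-\<beta>)) UNIV"
    using has_sum_imp_sums[OF abs_sum] *[OF assms(1)]
    by (intro norm_summable_imp_has_sum) (auto simp: sums_iff)
qed

lemma binomial_series_product:
  fixes x y \<beta> \<gamma> :: real
  assumes "\<bar>x\<bar> < 1" "\<bar>y\<bar> < 1" "\<beta> > 0" "\<gamma> > 0"
  shows "((\<lambda>(m, n). (pochhammer \<beta> m / fact m * x ^ m) * (pochhammer \<gamma> n / fact n * y ^ n)) has_sum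
           (1 - x) powr (-\<beta>) * (1 - y) powr (-\<gamma>)) UNIV" (is ?sum)
    and "finite S \<Longrightarrow>
           (\<Sum>(m, n)\<in>S. \<bar>(pochhammer \<beta> m / fact m * x ^ m) * (pochhammer \<gamma> n / fact n * y ^ n)\<bar>)
             \<le> (1 - \<bar>x\<bar>) powr (-\<beta>) * (1 - \<bar>y\<bar>) powr (-\<gamma>)" (is "_ \<Longrightarrow> ?bound")
proof -
  note 1 = binomial_series_has_sum[OF assms(1,3)]
  note 2 = binomial_series_has_sum[OF assms(2,4)]
  let ?f = "\<lambda>n. pochhammer \<beta> n / fact n * x ^ n"
  let ?g = "\<lambda>n. pochhammer \<gamma> n / fact n * y ^ n"
  have bound: "(\<Sum>(m, n)\<in>S. \<bar>?f m * ?g n\<bar>) \<le> (1 - \<bar>x\<bar>) powr (-\<beta>) * (1 - \<bar>y\<bar>) powr (-\<gamma>)"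
    if "finite S" for S
  proof -
    \<comment> \<open>A finite set of pairs lies in the rectangle spanned by its projections, over
      which the sum factors.\<close>
    have "(\<Sum>(m, n)\<in>S. \<bar>?f m * ?g n\<bar>) \<le> (\<Sum>(m, n)\<in>fst ` S \<times> snd ` S. \<bar>?f m * ?g n\<bar>)"
      using that by (intro sum_mono2) (auto intro: rev_image_eqI)
    also have "\<dots> = (\<Sum>m\<in>fst ` S. \<bar>?f m\<bar>) * (\<Sum>n\<in>snd ` S. \<bar>?g n\<bar>)"
      by (simp add: sum_product sum.cartesian_product abs_mult)
    also have "\<dots> \<le> (1 - \<bar>x\<bar>) powr (-\<beta>) * (1 - \<bar>y\<bar>) powr (-\<gamma>)"
      using that by (intro mult_mono sum_nonneg finite_sum_le_has_sum[OF 1(2)] finite_sum_le_has_sum[OF 2(2)]) auto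
    finally show ?thesis .
  qed
  thus "finite S \<Longrightarrow> ?bound" .
  have "(\<lambda>(m, n). \<bar>?f m * ?g n\<bar>) summable_on UNIV"
    using bound by (intro nonneg_bdd_above_summable_on bdd_aboveI) auto
  hence summ: "(\<lambda>(m, n). ?f m * ?g n) summable_on UNIV"
    using abs_summable_summable[of "\<lambda>(m, n). ?f m * ?g n" UNIV] by (simp add: case_prod_unfold)
  have "((\<lambda>(m, n). ?f m * ?g n) has_sum (1 - x) powr (-\<beta>) * (1 - y) powr (-\<gamma>)) (UNIV \<times> UNIV)"
  proof (rule has_sum_SigmaI)
    show "((\<lambda>n. case (m, n) of (m, n) \<Rightarrow> ?f m * ?g n) has_sum ?f m * (1 - y) powr (-\<gamma>)) UNIV" for m
      unfolding prod.case by (rule has_sum_cmult_right[OF 2(1)])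
    show "((\<lambda>m. ?f m * (1 - y) powr (-\<gamma>)) has_sum (1 - x) powr (-\<beta>) * (1 - y) powr (-\<gamma>)) UNIV"
      by (rule has_sum_cmult_left[OF 1(1)])
    show "(\<lambda>(m, n). ?f m * ?g n) summable_on UNIV \<times> UNIV"
      using summ by simp
  qed
  thus ?sum by simp
qed

text \<open>Along the diagonal m + n = k the binomial theorem collapses the terms to (2)_k / k! * (p
  + q)^k, which leaves the binomial series of exponent -2. The terms in absolute value give the same
  series at |p| + |q|, hence the form of the hypothesis.\<close>

lemma trinomial_series:
  fixes p q :: real
  assumes "\<bar>p\<bar> + \<bar>q\<bar> < 1"
  shows "((\<lambda>(m, n). pochhammer 2 (m + n) / (fact m * fact n) * p ^ m * q ^ n) has_sum
           1 / (1 - p - q)\<^sup>2) UNIV" (is ?sum)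
    and "finite S \<Longrightarrow> (\<Sum>(m, n)\<in>S. \<bar>pochhammer 2 (m + n) / (fact m * fact n) * p ^ m * q ^ n\<bar>)
           \<le> 1 / (1 - (\<bar>p\<bar> + \<bar>q\<bar>))\<^sup>2" (is "_ \<Longrightarrow> ?bound")
proof -
  let ?c = "\<lambda>m n. pochhammer 2 (m + n) / (fact m * fact n) :: real"
  have powr2: "z powr (-2) = 1 / z\<^sup>2" if "z > 0" for z :: real
    using that by (simp add: powr_minus_divide flip: powr_numeral)
  have diag: "(\<Sum>m\<le>k. ?c m (k - m) * p ^ m * q ^ (k - m)) = pochhammer 2 k / fact k * (p + q) ^ k"
    for k and p q :: real
  proof -
    have "(\<Sum>m\<le>k. ?c m (k - m) * p ^ m * q ^ (k - m))
        = (\<Sum>m\<le>k. pochhammer 2 k / fact k * (real (k choose m) * p ^ m * q ^ (k - m)))"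
      by (intro sum.cong) (auto simp: binomial_fact)
    thus ?thesis by (simp add: binomial_ring sum_distrib_left)
  qed
  define A :: "(nat \<times> nat) set" where "A = (SIGMA k:UNIV. {..k})"
  \<comment> \<open>Reindexes the quadrant by diagonals. The natural subtraction k - m is a true one
    because m <= k on \<open>A\<close>.\<close>
  define \<pi> :: "nat \<times> nat \<Rightarrow> nat \<times> nat" where "\<pi> = (\<lambda>(k, m). (m, k - m))"
  have bij: "bij_betw \<pi> A UNIV"
    by (rule bij_betwI[where g = "\<lambda>(m, n). (m + n, m)"]) (auto simp: A_def \<pi>_def)
  have bound: "(\<Sum>(m, n)\<in>S. \<bar>?c m n * p ^ m * q ^ n\<bar>) \<le> 1 / (1 - (\<bar>p\<bar> + \<bar>q\<bar>))\<^sup>2"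
    if "finite S" for S
  proof -
    let ?h = "\<lambda>(m, n). ?c m n * \<bar>p\<bar> ^ m * \<bar>q\<bar> ^ n"
    have poch: "pochhammer (2::real) k \<ge> 0" for k
      by (rule pochhammer_nonneg) auto
    hence c_nonneg: "?c m n \<ge> 0" for m n
      by (intro divide_nonneg_nonneg) auto
    \<comment> \<open>A triangle m + n <= N containing S; the inserted 0 keeps the maximum
      meaningful for empty S.\<close>
    define N where "N = Max (insert 0 ((\<lambda>(m, n). m + n) ` S))"
    have N: "m + n \<le> N" if "(m, n) \<in> S" for m n
      unfolding N_def using \<open>finite S\<close> that by (intro Max_ge) auto
    have "(\<Sum>(m, n)\<in>S. \<bar>?c m n * p ^ m * q ^ n\<bar>) = (\<Sum>x\<in>S. ?h x)"
      using poch by (intro sum.cong) (auto simp: abs_mult power_abs)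
    also have "\<dots> \<le> (\<Sum>x\<in>\<pi> ` (SIGMA k:{..N}. {..k}). ?h x)"
    proof (rule sum_mono2)
      show "S \<subseteq> \<pi> ` (SIGMA k:{..N}. {..k})"
      proof
        fix x assume "x \<in> S"
        thus "x \<in> \<pi> ` (SIGMA k:{..N}. {..k})"
          using N by (intro image_eqI[of _ _ "(fst x + snd x, fst x)"]) (auto simp: \<pi>_def)
      qed
      show "0 \<le> ?h x" for x
        using c_nonneg[of "fst x" "snd x"] unfolding case_prod_unfold by (intro mult_nonneg_nonneg) auto
    qed auto
    also have "\<dots> = (\<Sum>k\<le>N. \<Sum>m\<le>k. ?c m (k - m) * \<bar>p\<bar> ^ m * \<bar>q\<bar> ^ (k - m))"
      using bij by (subst sum.reindex)
        (auto simp: sum.Sigma \<pi>_def A_def bij_betw_def case_prod_unfold intro!: sum.cong elim!: inj_on_subset)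
    also have "\<dots> = (\<Sum>k\<le>N. pochhammer 2 k / fact k * (\<bar>p\<bar> + \<bar>q\<bar>) ^ k)"
      by (simp only: diag)
    also have "\<dots> \<le> (1 - (\<bar>p\<bar> + \<bar>q\<bar>)) powr (-2)"
      using assms by (intro finite_sum_le_has_sum[OF binomial_series_has_sum(1)])
        (auto intro!: mult_nonneg_nonneg divide_nonneg_nonneg pochhammer_nonneg)
    finally show ?thesis using assms by (simp add: powr2)
  qed
  thus "finite S \<Longrightarrow> ?bound" .
  have "(\<lambda>(m, n). \<bar>?c m n * p ^ m * q ^ n\<bar>) summable_on UNIV"
    using bound by (intro nonneg_bdd_above_summable_on bdd_aboveI) auto
  hence summ: "(\<lambda>(m, n). ?c m n * p ^ m * q ^ n) summable_on UNIV"
    using abs_summable_summable[of "\<lambda>(m, n). ?c m n * p ^ m * q ^ n" UNIV]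
    by (simp add: case_prod_unfold)
  have "((\<lambda>(k, m). ?c m (k - m) * p ^ m * q ^ (k - m)) has_sum 1 / (1 - p - q)\<^sup>2) A"
    unfolding A_def
  proof (rule has_sum_SigmaI)
    show "((\<lambda>m. case (k, m) of (k, m) \<Rightarrow> ?c m (k - m) * p ^ m * q ^ (k - m)) has_sum
            pochhammer 2 k / fact k * (p + q) ^ k) {..k}" for k
      unfolding prod.case by (rule has_sum_finiteI) (simp_all only: diag, simp_all)
    show "((\<lambda>k. pochhammer 2 k / fact k * (p + q) ^ k) has_sum 1 / (1 - p - q)\<^sup>2) UNIV"
      using binomial_series_has_sum(1)[of "p + q" 2] assms by (simp add: powr2 diff_diff_eq)
    show "(\<lambda>(k, m). ?c m (k - m) * p ^ m * q ^ (k - m)) summable_on (SIGMA k:UNIV. {..k})"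
      using summ summable_on_reindex_bij_betw[OF bij, of "\<lambda>(m, n). ?c m n * p ^ m * q ^ n"]
      by (simp add: \<pi>_def A_def case_prod_unfold)
  qed
  thus ?sum
    using has_sum_reindex_bij_betw[OF bij, of "\<lambda>(m, n). ?c m n * p ^ m * q ^ n"]
    by (simp add: \<pi>_def case_prod_unfold)
qed

subsection \<open>Integral representations of Appell's function\<close>

abbreviation "surface_measure \<equiv> slope_measure \<Otimes>\<^sub>M height_measure"

lemma finite_surface_measure: "finite_measure surface_measure"
  by (intro finite_measure_pair_measure finite_slope_measure finite_height_measure)

lemma space_surface_measure [simp]: "space surface_measure = UNIV \<times> {0..1}"
  by (simp add: space_pair_measure)

lemma pair_sigma_finite_surface: "pair_sigma_finite slope_measure height_measure"
  unfolding pair_sigma_finite_def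
  using finite_slope_measure finite_height_measure by (simp add: finite_measure_def)

lemma measurable_snd_surface [measurable]: "snd \<in> borel_measurable surface_measure"
proof -
  have "(\<lambda>t::real. t) \<in> borel_measurable height_measure"
    unfolding height_measure_def by (intro measurable_restrict_space1) simp
  from measurable_compose[OF measurable_snd this] show ?thesis .
qed

lemma measurable_fst_surface [measurable]: "fst \<in> borel_measurable surface_measure"
  using measurable_compose[OF measurable_fst, of "\<lambda>w. w" slope_measure borel height_measure]
  by (simp add: measurable_ident_sets)

text \<open>The variables separate, and the n! of the beta integral cancels the 1/n! of the Wallis
  integral. That leaves the single symbol (1/2)_n, the third parameter of the Appell
  function.\<close>

lemma integral_surface_measure_moment:
  "(\<integral>x. snd x ^ (2 * k) * (1 - (snd x)\<^sup>2) ^ n * sin2_of_slope (fst x) ^ n \<partial>surface_measure)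
     = pi * pochhammer (1/2) n / (2 * pochhammer (k + 1/2) (Suc n))"
proof -
  interpret pair_sigma_finite slope_measure height_measure by (rule pair_sigma_finite_surface)
  let ?f = "\<lambda>x. snd x ^ (2 * k) * (1 - (snd x)\<^sup>2) ^ n * sin2_of_slope (fst x) ^ n"
  have "integrable surface_measure ?f"
  proof (rule finite_measure.integrable_const_bound[OF finite_surface_measure, of _ 1])
    have "norm (?f (w, t)) \<le> 1" if "t \<in> {0..1}" for w t
      using that
      by (auto intro!: mult_le_one power_le_one simp: abs_mult power_abs sin2_of_slope_bounds power_le_one_iff)
    thus "AE x in surface_measure. norm (?f x) \<le> 1" by (intro AE_I2) auto
  qed measurable
  from integral_fst'[OF this]
  have "(\<integral>x. ?f x \<partial>surface_measure) =
     (\<integral>w. sin2_of_slope w ^ n * (\<integral>t. t ^ (2 * k) * (1 - t\<^sup>2) ^ n \<partial>height_measure) \<partial>slope_measure)"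
    by (simp add: mult_ac)
  also have "\<dots> = (\<integral>w. sin2_of_slope w ^ n \<partial>slope_measure) * (\<integral>t. t ^ (2 * k) * (1 - t\<^sup>2) ^ n \<partial>height_measure)"
    by simp
  also have "\<dots> = pi * pochhammer (1/2) n / (2 * pochhammer (k + 1/2) (Suc n))"
    by (simp only: integral_sin2_of_slope_power integral_height_measure_beta) simp
  finally show ?thesis .
qed

text \<open>With u = t^2 and s = sin^2 \<phi> this puts the trinomial series inside its domain
  uniformly in the point, as soon as |X| and |y| are each below 1.\<close>

lemma convex_combination_abs_le:
  fixes u X y s :: real
  assumes "0 \<le> u" "u \<le> 1" "0 \<le> s" "s \<le> 1"
  shows "\<bar>X * u\<bar> + \<bar>y * ((1 - u) * s)\<bar> \<le> max \<bar>X\<bar> \<bar>y\<bar>"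
proof -
  have "\<bar>X * u\<bar> + \<bar>y * ((1 - u) * s)\<bar> = \<bar>X\<bar> * u + \<bar>y\<bar> * ((1 - u) * s)"
    using assms by (simp add: abs_mult)
  also have "\<dots> \<le> max \<bar>X\<bar> \<bar>y\<bar> * u + max \<bar>X\<bar> \<bar>y\<bar> * (1 - u)"
    using assms by (intro add_mono mult_mono mult_left_le) auto
  finally show ?thesis by (simp add: algebra_simps)
qed

text \<open>Expand the inverse square by \<open>trinomial_series\<close> and integrate each
  monomial. The exponent 2j serves both cases: j = 0 for the expansion around b^2, j = 1 for the
  inverted tail, where the Jacobian of t = 1/s leaves a factor t^2.\<close>

lemma appell_F1_double_integral:
  fixes X y :: real and j :: nat
  assumes X: "\<bar>X\<bar> < 1" and y: "\<bar>y\<bar> < 1"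
  defines "f \<equiv> \<lambda>x. snd x ^ (2 * j) / (1 - X * (snd x)\<^sup>2 - y * ((1 - (snd x)\<^sup>2) * sin2_of_slope (fst x)))\<^sup>2"
  shows "integrable surface_measure f"
    and "(\<integral>x. f x \<partial>surface_measure) = pi / (2 * j + 1) * appell_F1 2 (j + 1/2) (1/2) (j + 3/2) X y"
proof -
  let ?\<phi> = "\<lambda>(m, n) x. pochhammer 2 (m + n) / (fact m * fact n) * (X * (snd x)\<^sup>2) ^ m
               * (y * ((1 - (snd x)\<^sup>2) * sin2_of_slope (fst x))) ^ n * snd x ^ (2 * j)"
  let ?r = "max \<bar>X\<bar> \<bar>y\<bar>"
  have r: "?r < 1" using X y by simp
  have le_r: "\<bar>X * (snd x)\<^sup>2\<bar> + \<bar>y * ((1 - (snd x)\<^sup>2) * sin2_of_slope (fst x))\<bar> \<le> ?r"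
    if "x \<in> space surface_measure" for x
    using that by (intro convex_combination_abs_le sin2_of_slope_bounds) (auto simp: power_le_one)
  have sum: "((\<lambda>k. ?\<phi> k x) has_sum f x) UNIV" if "x \<in> space surface_measure" for x
    using has_sum_cmult_left[OF trinomial_series(1), OF le_less_trans[OF le_r[OF that] r], of "snd x ^ (2 * j)"]
    unfolding f_def by (simp add: case_prod_unfold)
  have bound: "(\<Sum>k\<in>S. \<bar>?\<phi> k x\<bar>) \<le> 1 / (1 - ?r)\<^sup>2"
    if "x \<in> space surface_measure" "finite S" for x S
  proof -
    define p q where "p = X * (snd x)\<^sup>2" and "q = y * ((1 - (snd x)\<^sup>2) * sin2_of_slope (fst x))"
    have t: "\<bar>snd x ^ (2 * j)\<bar> \<le> 1" using that(1) by (auto simp: power_abs intro!: power_le_one)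
    have "(\<Sum>k\<in>S. \<bar>?\<phi> k x\<bar>) \<le> (\<Sum>(m, n)\<in>S. \<bar>pochhammer 2 (m + n) / (fact m * fact n) * p ^ m * q ^ n\<bar>)"
      unfolding p_def[symmetric] q_def[symmetric] case_prod_unfold abs_mult[of _ "snd x ^ (2 * j)"]
      by (intro sum_mono mult_right_le_one_le t) auto
    also have "\<dots> \<le> 1 / (1 - (\<bar>p\<bar> + \<bar>q\<bar>))\<^sup>2"
      using le_less_trans[OF le_r[OF that(1)] r] that(2) by (intro trinomial_series(2)) (simp_all add: p_def q_def)
    also have "\<dots> \<le> 1 / (1 - ?r)\<^sup>2"
      using le_r[OF that(1)] r by (intro divide_left_mono power_mono mult_pos_pos) (auto simp: p_def q_def)
    finally show ?thesis .
  qed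
  have meas: "?\<phi> k \<in> borel_measurable surface_measure" for k
    unfolding case_prod_unfold by measurable
  note * = has_sum_integral_bounded[OF finite_surface_measure, of ?\<phi>, OF meas sum bound]
  show "integrable surface_measure f" by (rule *(2))
  have term_eq: "(\<integral>x. ?\<phi> (m, n) x \<partial>surface_measure) =
      pi / (2 * j + 1) * (pochhammer 2 (m + n) * pochhammer (j + 1/2) m * pochhammer (1/2) n
        / (pochhammer (j + 3/2) (m + n) * fact m * fact n) * X ^ m * y ^ n)" for m n
  proof -
    have sq: "(t\<^sup>2) ^ m = (t ^ m)\<^sup>2" for t :: real
      by (simp flip: power_mult add: mult.commute)
    have "(\<integral>x. ?\<phi> (m, n) x \<partial>surface_measure)
        = (\<integral>x. (pochhammer 2 (m + n) / (fact m * fact n) * X ^ m * y ^ n)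
            * (snd x ^ (2 * (m + j)) * (1 - (snd x)\<^sup>2) ^ n * sin2_of_slope (fst x) ^ n) \<partial>surface_measure)"
      by (intro Bochner_Integration.integral_cong)
         (simp_all add: power_mult_distrib power_add power_mult sq mult_ac)
    also have "\<dots> = (pochhammer 2 (m + n) / (fact m * fact n) * X ^ m * y ^ n) *
        (pi * pochhammer (1/2) n * (1 / (2 * pochhammer (real (m + j) + 1/2) (Suc n))))"
      by (subst integral_mult_right_zero, subst integral_surface_measure_moment) simp
    also have "1 / (2 * pochhammer (real (m + j) + 1/2) (Suc n))
       = pochhammer (j + 1/2) m / ((2 * j + 1) * pochhammer (j + 3/2) (m + n))"
    proof -
      \<comment> \<open>The two symbols concatenate to (j + 1/2)_(m+n+1). Removing its first factor
        yields the prefactor 1 / (2j + 1) and the lower parameter j + 3/2, while (j + 1/2)_m moves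
        to the numerator.\<close>
      have "pochhammer (j + 1/2) m * pochhammer (real (m + j) + 1/2) (Suc n) = pochhammer (real j + 1/2) (Suc (m + n))"
        using pochhammer_product'[of "real j + 1/2" m "Suc n"] by (simp add: add_ac)
      also have "\<dots> = (j + 1/2) * pochhammer (j + 3/2) (m + n)"
        by (subst pochhammer_rec) (simp add: add_ac)
      finally have eq: "pochhammer (j + 1/2) m * (2 * pochhammer (real (m + j) + 1/2) (Suc n))
          = (2 * j + 1) * pochhammer (j + 3/2) (m + n)"
        by (simp add: algebra_simps)
      have "pochhammer (real (m + j) + 1/2) (Suc n) > 0" "pochhammer (real j + 3/2) (m + n) > 0"
        by (intro pochhammer_pos; simp)+
      thus ?thesis using eq by (simp add: frac_eq_eq del: pochhammer_Suc)
    qed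
    also have "(pochhammer 2 (m + n) / (fact m * fact n) * X ^ m * y ^ n) * (pi * pochhammer (1/2) n *
          (pochhammer (j + 1/2) m / ((2 * j + 1) * pochhammer (j + 3/2) (m + n))))
        = pi / (2 * j + 1) * (pochhammer 2 (m + n) * pochhammer (j + 1/2) m * pochhammer (1/2) n
        / (pochhammer (j + 3/2) (m + n) * fact m * fact n) * X ^ m * y ^ n)"
      by (simp add: mult_ac)
    finally show ?thesis .
  qed
  show "(\<integral>x. f x \<partial>surface_measure) = pi / (2 * j + 1) * appell_F1 2 (j + 1/2) (1/2) (j + 3/2) X y"
    unfolding appell_F1_def infsum_cmult_right'[symmetric]
    by (rule infsumI[symmetric], rule has_sum_cong[THEN iffD1, OF _ *(1)])
       (auto simp only: term_eq[unfolded prod.case] split: prod.split)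
qed

text \<open>Here both series run in the same variable, so sin^2 \<phi> occurs to the power m + n.
  Its Wallis integral is pi * (1/2)_(m+n) / (1)_(m+n), which explains the parameters 1/2 and
  1.\<close>

lemma appell_F1_single_integral:
  fixes X y :: real
  assumes X: "\<bar>X\<bar> < 1" and y: "\<bar>y\<bar> < 1" and \<beta>: "\<beta> > 0" and \<gamma>: "\<gamma> > 0"
  shows "(\<integral>w. (1 - X * sin2_of_slope w) powr (-\<beta>) * (1 - y * sin2_of_slope w) powr (-\<gamma>) \<partial>slope_measure)
           = pi * appell_F1 (1/2) \<beta> \<gamma> 1 X y"
proof -
  let ?s = sin2_of_slope
  let ?\<phi> = "\<lambda>(m, n) w. (pochhammer \<beta> m / fact m * (X * ?s w) ^ m) * (pochhammer \<gamma> n / fact n * (y * ?s w) ^ n)"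
  let ?f = "\<lambda>w. (1 - X * ?s w) powr (-\<beta>) * (1 - y * ?s w) powr (-\<gamma>)"
  have le: "\<bar>z * ?s w\<bar> \<le> \<bar>z\<bar>" for z w
    by (simp add: abs_mult mult_left_le sin2_of_slope_bounds)
  have lt: "\<bar>X * ?s w\<bar> < 1" "\<bar>y * ?s w\<bar> < 1" for w
    using le[of X w] le[of y w] X y by linarith+
  have sum: "((\<lambda>k. ?\<phi> k w) has_sum ?f w) UNIV" for w
    using binomial_series_product(1)[OF lt \<beta> \<gamma>] by (simp add: case_prod_unfold)
  have bound: "(\<Sum>k\<in>S. \<bar>?\<phi> k w\<bar>) \<le> (1 - \<bar>X\<bar>) powr (-\<beta>) * (1 - \<bar>y\<bar>) powr (-\<gamma>)" if "finite S" for w S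
  proof -
    have "(\<Sum>k\<in>S. \<bar>?\<phi> k w\<bar>) \<le> (1 - \<bar>X * ?s w\<bar>) powr (-\<beta>) * (1 - \<bar>y * ?s w\<bar>) powr (-\<gamma>)"
      using binomial_series_product(2)[OF lt \<beta> \<gamma> that] by (simp add: case_prod_unfold)
    also have "\<dots> \<le> (1 - \<bar>X\<bar>) powr (-\<beta>) * (1 - \<bar>y\<bar>) powr (-\<gamma>)"
      using le[of X w] le[of y w] X y \<beta> \<gamma> by (intro mult_mono powr_mono2') auto
    finally show ?thesis .
  qed
  have meas: "?\<phi> k \<in> borel_measurable slope_measure" for k
    unfolding case_prod_unfold by measurable
  note * = has_sum_integral_bounded[OF finite_slope_measure, of ?\<phi> ?f, OF meas sum bound]
  have term_eq: "(\<integral>w. ?\<phi> (m, n) w \<partial>slope_measure) =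
      pi * (pochhammer (1/2) (m + n) * pochhammer \<beta> m * pochhammer \<gamma> n
        / (pochhammer 1 (m + n) * fact m * fact n) * X ^ m * y ^ n)" for m n
  proof -
    have "(\<integral>w. ?\<phi> (m, n) w \<partial>slope_measure)
        = (\<integral>w. (pochhammer \<beta> m / fact m * X ^ m * (pochhammer \<gamma> n / fact n * y ^ n)) * ?s w ^ (m + n) \<partial>slope_measure)"
      by (intro Bochner_Integration.integral_cong) (simp_all add: power_mult_distrib power_add mult_ac)
    also have "\<dots> = (pochhammer \<beta> m / fact m * X ^ m * (pochhammer \<gamma> n / fact n * y ^ n))
        * (pi * pochhammer (1/2) (m + n) / fact (m + n))"
      by (subst integral_mult_right_zero) (simp only: integral_sin2_of_slope_power)
    finally show ?thesis by (simp add: pochhammer_fact[symmetric] mult_ac)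
  qed
  show ?thesis
    unfolding appell_F1_def infsum_cmult_right'[symmetric]
    by (rule infsumI[symmetric], rule has_sum_cong[THEN iffD1, OF _ *(1)])
       (auto simp only: term_eq[unfolded prod.case] split: prod.split)
qed

text \<open>\<open>appell_F1_double_integral\<close> attaches the first argument to the height
  variable, whereas Case I lists the arguments in the opposite order.\<close>

lemma appell_F1_swap: "appell_F1 \<alpha> \<beta> \<gamma> \<delta> x y = appell_F1 \<alpha> \<gamma> \<beta> \<delta> y x"
  unfolding appell_F1_def
  by (subst infsum_reindex_bij_betw[OF bij_swap, symmetric]) (simp add: case_prod_unfold mult_ac add_ac)

subsection \<open>The surface area as an integral over normal directions\<close>

text \<open>One chord of the ellipse, along which the direction of the normal in the base plane is
  constant up to sign. The new variable t is the reciprocal of the square root on the left.\<close>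

lemma radial_substitution:
  fixes K M :: real
  assumes K: "K > 0" and M: "M > 0"
  shows "(\<integral>\<^sup>+y. ennreal (\<bar>y\<bar> * sqrt (1 + M * y\<^sup>2 / (1 - K * y\<^sup>2))) * indicator {y. K * y\<^sup>2 < 1} y \<partial>lborel)
       = (\<integral>\<^sup>+t. ennreal (2 * M / (K * (1 - t\<^sup>2) + M * t\<^sup>2)\<^sup>2) * indicator {0..1} t \<partial>lborel)"
proof -
  define f where "f = (\<lambda>y::real. \<bar>y\<bar> * sqrt (1 + M * y\<^sup>2 / (1 - K * y\<^sup>2)))"
  define D where "D = (\<lambda>t::real. K * (1 - t\<^sup>2) + M * t\<^sup>2)"
  \<comment> \<open>The positive solution y of 1 + M y^2 / (1 - K y^2) = 1 / t^2.\<close>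
  define g where "g = (\<lambda>t::real. sqrt ((1 - t\<^sup>2) / D t))"
  define g' where "g' = (\<lambda>t::real. - (t * M / (D t)\<^sup>2) / g t)"
  define I where "I = {y. 0 < y \<and> K * y\<^sup>2 < 1}"
  have D_pos: "D t > 0" if "t \<in> {0..1}" for t
  proof (cases "t = 1")
    case False
    with that have "t\<^sup>2 < 1" by (simp add: power_less_one_iff abs_square_less_1)
    with K M show ?thesis unfolding D_def by (intro add_pos_nonneg) auto
  qed (use M in \<open>simp add: D_def\<close>)
  have t_sq: "0 < t\<^sup>2" "t\<^sup>2 < 1" if "t \<in> {0<..<1}" for t :: real
    using that by (auto simp: power_less_one_iff abs_square_less_1)
  have g_pos: "g t > 0" and g_sq: "(g t)\<^sup>2 = (1 - t\<^sup>2) / D t" if "t \<in> {0<..<1}" for t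
    using D_pos[of t] that t_sq[OF that] by (auto simp: g_def)
  have one_minus: "1 - K * (g t)\<^sup>2 = M * t\<^sup>2 / D t" if "t \<in> {0<..<1}" for t
    using D_pos[of t] that unfolding g_sq[OF that] by (simp add: field_simps) (simp add: D_def algebra_simps)
  have ratio: "M * (g t)\<^sup>2 / (1 - K * (g t)\<^sup>2) = (1 - t\<^sup>2) / t\<^sup>2" if "t \<in> {0<..<1}" for t
    using D_pos[of t] that M unfolding one_minus[OF that] unfolding g_sq[OF that] by simp
  \<comment> \<open>The area element 1/t cancels the factor t of \<open>g'\<close>, and the weight
    |y| cancels its denominator \<open>g t\<close>. No singularity is left at either end.\<close>
  have integrand: "\<bar>g' t\<bar> * f (g t) = M / (D t)\<^sup>2" if "t \<in> {0<..<1}" for t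
  proof -
    have "f (g t) = g t * sqrt (1 + (1 - t\<^sup>2) / t\<^sup>2)"
      using g_pos[OF that] by (simp add: f_def ratio[OF that])
    also have "1 + (1 - t\<^sup>2) / t\<^sup>2 = (1 / t)\<^sup>2"
      using that by (simp add: field_simps)
    finally have "f (g t) = g t / t" using that by (simp add: real_sqrt_divide)
    thus ?thesis using g_pos[OF that] that M by (simp add: g'_def abs_mult)
  qed
  have deriv: "(g has_field_derivative g' t) (at t within {0<..<1})" if "t \<in> {0<..<1}" for t
  proof -
    have "(D has_field_derivative 2 * t * (M - K)) (at t)"
      unfolding D_def by (auto intro!: derivative_eq_intros simp: algebra_simps)
    moreover have "((\<lambda>t. 1 - t\<^sup>2) has_field_derivative - 2 * t) (at t)"
      by (auto intro!: derivative_eq_intros)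
    ultimately have "((\<lambda>t. (1 - t\<^sup>2) / D t) has_field_derivative
        (- 2 * t * D t - (1 - t\<^sup>2) * (2 * t * (M - K))) / (D t * D t)) (at t)"
      using D_pos[of t] that by (intro DERIV_divide) auto
    moreover have "- 2 * t * D t - (1 - t\<^sup>2) * (2 * t * (M - K)) = - (2 * t * M)"
      by (simp add: D_def algebra_simps)
    ultimately have "((\<lambda>t. (1 - t\<^sup>2) / D t) has_field_derivative - (2 * t * M) / (D t * D t)) (at t)"
      by (simp only:)
    hence "((\<lambda>t. sqrt ((1 - t\<^sup>2) / D t)) has_field_derivative
        inverse (sqrt ((1 - t\<^sup>2) / D t)) / 2 * (- (2 * t * M) / (D t * D t))) (at t)"
      using g_pos[OF that] by (intro DERIV_chain2[where f = sqrt] DERIV_real_sqrt) (simp_all add: g_def)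
    moreover have "inverse (sqrt ((1 - t\<^sup>2) / D t)) / 2 * (- (2 * t * M) / (D t * D t)) = g' t"
      unfolding g'_def g_def by (simp add: inverse_eq_divide power2_eq_square)
    ultimately have "((\<lambda>t. sqrt ((1 - t\<^sup>2) / D t)) has_field_derivative g' t) (at t)"
      by (simp only:)
    thus ?thesis unfolding g_def by (rule DERIV_subset) simp
  qed
  have inj: "inj_on g {0<..<1}"
  proof (rule inj_onI)
    fix s t assume st: "s \<in> {0<..<1}" "t \<in> {0<..<1}" "g s = g t"
    have D: "D s > 0" "D t > 0" using D_pos st by auto
    have "(1 - s\<^sup>2) / D s = (1 - t\<^sup>2) / D t" using g_sq st by metis
    hence "(1 - s\<^sup>2) * D t = (1 - t\<^sup>2) * D s" using D by (simp add: field_simps)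
    hence "M * (s\<^sup>2 - t\<^sup>2) = 0" unfolding D_def by (auto simp: algebra_simps)
    hence "s\<^sup>2 = t\<^sup>2" using M by simp
    thus "s = t" using st by (simp add: power2_eq_iff)
  qed
  have img: "g ` {0<..<1} = I"
  proof (intro equalityI subsetI)
    fix y assume "y \<in> g ` {0<..<1}"
    then obtain t where t: "t \<in> {0<..<1}" "y = g t" by auto
    have "1 - K * (g t)\<^sup>2 > 0"
      unfolding one_minus[OF t(1)] using D_pos[of t] t M by simp
    thus "y \<in> I" using g_pos t by (simp add: I_def)
  next
    fix y assume "y \<in> I"
    hence y: "y > 0" "1 - K * y\<^sup>2 > 0" by (auto simp: I_def)
    \<comment> \<open>The value of t^2 that belongs to y, that is, the reciprocal of 1 + M y^2 / (1
      - K y^2).\<close>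
    define u where "u = (1 - K * y\<^sup>2) / (1 - K * y\<^sup>2 + M * y\<^sup>2)"
    have den: "1 - K * y\<^sup>2 + M * y\<^sup>2 > 0" using y M by (intro add_pos_nonneg) auto
    have u: "0 < u" "u < 1" using y M den by (auto simp: u_def)
    have t: "sqrt u \<in> {0<..<1}" using u by simp
    have u': "1 - u = M * y\<^sup>2 / (1 - K * y\<^sup>2 + M * y\<^sup>2)" using den by (simp add: u_def field_simps)
    have "D (sqrt u) = K * (1 - u) + M * u" using u by (simp add: D_def)
    also have "\<dots> = (K * (M * y\<^sup>2) + M * (1 - K * y\<^sup>2)) / (1 - K * y\<^sup>2 + M * y\<^sup>2)"
      unfolding u' by (simp add: u_def add_divide_distrib)
    also have "K * (M * y\<^sup>2) + M * (1 - K * y\<^sup>2) = M" by (simp add: algebra_simps)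
    finally have "(g (sqrt u))\<^sup>2 = y\<^sup>2"
      using g_sq[OF t] den M u u' by simp
    hence "g (sqrt u) = y" using g_pos[OF t] y by (simp add: power2_eq_iff)
    thus "y \<in> g ` {0<..<1}" using t by blast
  qed
  have cont: "continuous_on {0..1} (\<lambda>t. M / (D t)\<^sup>2)"
    using D_pos unfolding D_def by (intro continuous_intros) (auto simp: less_imp_neq[symmetric])
  have abs_int: "(\<lambda>t. M / (D t)\<^sup>2) absolutely_integrable_on {0<..<1}"
    using absolutely_integrable_continuous_real[OF cont]
    by (rule set_integrable_subset) auto
  define b where "b = integral {0<..<1} (\<lambda>t. M / (D t)\<^sup>2)"
  have "(\<lambda>t. \<bar>g' t\<bar> * f (g t)) absolutely_integrable_on {0<..<1}
        \<longleftrightarrow> (\<lambda>t. M / (D t)\<^sup>2) absolutely_integrable_on {0<..<1}"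
    by (intro set_integrable_cong refl integrand)
  moreover have "integral {0<..<1} (\<lambda>t. \<bar>g' t\<bar> * f (g t)) = b"
    unfolding b_def by (intro integral_cong integrand)
  ultimately have "f absolutely_integrable_on I \<and> integral I f = b"
    using has_absolute_integral_change_of_variables_1'[OF _ deriv inj, of f b] img abs_int by auto
  hence "(f has_integral b) I"
    by (metis integrable_integral set_lebesgue_integral_eq_integral(1))
  moreover have f_nonneg: "f y \<ge> 0" if "K * y\<^sup>2 < 1" for y
    using that M unfolding f_def by auto
  ultimately have half: "(\<integral>\<^sup>+y. ennreal (f y) * indicator I y \<partial>lborel) = ennreal b"
    by (intro nn_integral_has_integral_lebesgue') (auto simp: I_def)
  have [measurable]: "f \<in> borel_measurable borel" "I \<in> sets borel"
    unfolding f_def I_def by measurable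
  \<comment> \<open>The substitution covers y > 0 only. Evenness of \<open>f\<close> accounts for
    the other half and for the factor 2; the point y = 0 is null.\<close>
  have "(\<integral>\<^sup>+y. ennreal (f y) * indicator {y. K * y\<^sup>2 < 1} y \<partial>lborel)
      = (\<integral>\<^sup>+y. ennreal (f y) * indicator I y + ennreal (f (- y)) * indicator I (- y) \<partial>lborel)"
    by (intro nn_integral_cong_AE eventually_mono[OF AE_lborel_singleton[of 0]])
       (auto simp: I_def f_def split: split_indicator)
  also have "\<dots> = (\<integral>\<^sup>+y. ennreal (f y) * indicator I y \<partial>lborel) + (\<integral>\<^sup>+y. ennreal (f (- y)) * indicator I (- y) \<partial>lborel)"
    by (intro nn_integral_add) measurable
  also have "(\<integral>\<^sup>+y. ennreal (f (- y)) * indicator I (- y) \<partial>lborel) = (\<integral>\<^sup>+y. ennreal (f y) * indicator I y \<partial>lborel)"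
    using nn_integral_real_affine[of "\<lambda>y. ennreal (f y) * indicator I y" "-1" 0] by simp
  also note half
  also have "ennreal b = (\<integral>\<^sup>+t. ennreal (M / (D t)\<^sup>2) * indicator {0<..<1} t \<partial>lborel)"
    unfolding b_def using M abs_int
    by (intro nn_integral_has_integral_lebesgue'[symmetric] integrable_integral)
       (auto dest: set_lebesgue_integral_eq_integral(1))
  also have "\<dots> = (\<integral>\<^sup>+t. ennreal (M / (D t)\<^sup>2) * indicator {0..1} t \<partial>lborel)"
    by (intro nn_integral_cong_AE eventually_mono[OF eventually_conj[OF AE_lborel_singleton[of 0] AE_lborel_singleton[of 1]]])
       (auto split: split_indicator)
  also have "\<dots> + \<dots> = (\<integral>\<^sup>+t. ennreal (M / (D t)\<^sup>2) * indicator {0..1} t + ennreal (M / (D t)\<^sup>2) * indicator {0..1} t \<partial>lborel)"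
    unfolding D_def by (intro nn_integral_add[symmetric]) measurable
  also have "\<dots> = (\<integral>\<^sup>+t. ennreal (2 * M / (D t)\<^sup>2) * indicator {0..1} t \<partial>lborel)"
    using M by (intro nn_integral_cong) (auto simp flip: ennreal_plus split: split_indicator)
  finally show ?thesis unfolding f_def D_def .
qed

text \<open>An interior point stays in the region when scaled by some s > 1, so s^2 times its
  quadratic form is still at most 1 and the form itself is strictly smaller.\<close>

lemma interior_elliptical_region:
  assumes "b > 0" "c > 0"
  shows "interior (elliptical_region b c) = {(y, z). y\<^sup>2 / b\<^sup>2 + z\<^sup>2 / c\<^sup>2 < 1}" (is "_ = ?E")
proof
  have "open {x :: real \<times> real. (fst x)\<^sup>2 / b\<^sup>2 + (snd x)\<^sup>2 / c\<^sup>2 < 1}"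
    using assms by (intro open_Collect_less continuous_intros) auto
  moreover have "{x :: real \<times> real. (fst x)\<^sup>2 / b\<^sup>2 + (snd x)\<^sup>2 / c\<^sup>2 < 1} = ?E" by auto
  ultimately show "?E \<subseteq> interior (elliptical_region b c)"
    by (intro interior_maximal) (auto simp: elliptical_region_def)
  show "interior (elliptical_region b c) \<subseteq> ?E"
  proof
    fix x assume x: "x \<in> interior (elliptical_region b c)"
    let ?N = "\<lambda>x::real \<times> real. (fst x)\<^sup>2 / b\<^sup>2 + (snd x)\<^sup>2 / c\<^sup>2"
    have "((\<lambda>s. s *\<^sub>R x) \<longlongrightarrow> 1 *\<^sub>R x) (at_right (1::real))"
      by (intro tendsto_intros)
    hence "\<forall>\<^sub>F s in at_right 1. s *\<^sub>R x \<in> interior (elliptical_region b c)"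
      using x by (intro topological_tendstoD) auto
    moreover have "\<forall>\<^sub>F s in at_right (1::real). s > 1"
      by (simp add: eventually_at_right_less)
    ultimately have "\<forall>\<^sub>F s in at_right (1::real). s > 1 \<and> s *\<^sub>R x \<in> elliptical_region b c"
      by eventually_elim (use interior_subset in blast)
    then obtain s :: real where s: "s > 1" "s *\<^sub>R x \<in> elliptical_region b c"
      using eventually_happens[of _ "at_right (1::real)"] by (auto simp: trivial_limit_at_right_real)
    have "s\<^sup>2 * ?N x \<le> 1"
      using s(2) by (auto simp: elliptical_region_def case_prod_unfold power_mult_distrib algebra_simps)
    moreover have "s\<^sup>2 > 1" using s by simp
    moreover have "?N x \<ge> 0" by simp
    ultimately have "?N x < 1"
      by (smt (verit) mult_less_cancel_right1)
    thus "x \<in> ?E" by (simp add: case_prod_unfold)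
  qed
qed

section \<open>The area element and its passage to normal directions\<close>

lemma deriv_scaled_sqrt:
  assumes "r - y\<^sup>2 / b\<^sup>2 > 0"
  shows "deriv (\<lambda>t. a * sqrt (r - t\<^sup>2 / b\<^sup>2)) y = - (a * y / (b\<^sup>2 * sqrt (r - y\<^sup>2 / b\<^sup>2)))"
proof (rule DERIV_imp_deriv)
  have "((\<lambda>t. r - t\<^sup>2 / b\<^sup>2) has_field_derivative - (2 * y / b\<^sup>2)) (at y)"
    by (auto intro!: derivative_eq_intros simp: divide_inverse)
  from DERIV_cmult[OF DERIV_chain2[where f = sqrt, OF DERIV_real_sqrt[OF assms] this], of a]
  show "((\<lambda>t. a * sqrt (r - t\<^sup>2 / b\<^sup>2)) has_field_derivative
          - (a * y / (b\<^sup>2 * sqrt (r - y\<^sup>2 / b\<^sup>2)))) (at y)"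
    by (simp add: inverse_eq_divide mult.commute)
qed

lemma hemiellipsoid_area_element:
  assumes "y\<^sup>2 / b\<^sup>2 + z\<^sup>2 / c\<^sup>2 < 1"
  shows "1 + (deriv (\<lambda>t. hemiellipsoid a b c t z) y)\<^sup>2 + (deriv (\<lambda>t. hemiellipsoid a b c y t) z)\<^sup>2
       = 1 + a\<^sup>2 * (y\<^sup>2 / b ^ 4 + z\<^sup>2 / c ^ 4) / (1 - (y\<^sup>2 / b\<^sup>2 + z\<^sup>2 / c\<^sup>2))"
proof -
  define q where "q = 1 - (y\<^sup>2 / b\<^sup>2 + z\<^sup>2 / c\<^sup>2)"
  have q: "q > 0" using assms by (simp add: q_def)
  have 1: "deriv (\<lambda>t. hemiellipsoid a b c t z) y = - (a * y / (b\<^sup>2 * sqrt q))"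
    using deriv_scaled_sqrt[of "1 - z\<^sup>2 / c\<^sup>2" y b a] q
    by (simp add: q_def hemiellipsoid_def algebra_simps)
  have 2: "deriv (\<lambda>t. hemiellipsoid a b c y t) z = - (a * z / (c\<^sup>2 * sqrt q))"
    using deriv_scaled_sqrt[of "1 - y\<^sup>2 / b\<^sup>2" z c a] q
    by (simp add: q_def hemiellipsoid_def algebra_simps)
  have "(b\<^sup>2)\<^sup>2 = b ^ 4" "(c\<^sup>2)\<^sup>2 = c ^ 4" by simp_all
  thus ?thesis unfolding 1 2 q_def[symmetric] using q
    by (simp add: power_divide power_mult_distrib distrib_left add_divide_distrib)
qed

text \<open>The computation runs through nonnegative extended integrals, so that the order of
  integration can be exchanged by Tonelli without any prior integrability. \<open>B w\<close> is b^2
  cos^2 \<phi> + c^2 sin^2 \<phi>.\<close>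

lemma curved_surface_area_hemiellipsoid:
  assumes a: "a > 0" and b: "b > 0" and c: "c > 0"
  defines "B \<equiv> \<lambda>w. b\<^sup>2 - (b\<^sup>2 - c\<^sup>2) * sin2_of_slope w"
  shows "curved_surface_area (hemiellipsoid a b c) (elliptical_region b c) =
    (\<integral>x. 2 * a\<^sup>2 * b\<^sup>2 * c\<^sup>2 / (B (fst x) * (1 - (snd x)\<^sup>2) + a\<^sup>2 * (snd x)\<^sup>2)\<^sup>2 \<partial>surface_measure)"
proof -
  interpret H: sigma_finite_measure height_measure
    using finite_height_measure by (simp add: finite_measure_def)
  define q where "q = (\<lambda>y z. 1 - (y\<^sup>2 / b\<^sup>2 + z\<^sup>2 / c\<^sup>2))"
  define f where "f = (\<lambda>y z. sqrt (1 + a\<^sup>2 * (y\<^sup>2 / b ^ 4 + z\<^sup>2 / c ^ 4) / q y z))"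
  define G where "G = (\<lambda>y z. ennreal (f y z) * indicator {0<..} (q y z))"
  \<comment> \<open>With \<open>z = k y w\<close> the normal direction \<open>(y / b\<^sup>2, z / c\<^sup>2)\<close> in the base plane has slope \<open>w\<close>.\<close>
  define k where "k = c\<^sup>2 / b\<^sup>2"
  have k: "k > 0" using b c by (simp add: k_def)
  have q_meas [measurable]: "(\<lambda>x. q (fst x) (snd x)) \<in> borel_measurable (borel \<Otimes>\<^sub>M borel)"
    unfolding q_def by measurable
  have f_meas [measurable]: "(\<lambda>x. f (fst x) (snd x)) \<in> borel_measurable (borel \<Otimes>\<^sub>M borel)"
    unfolding f_def by measurable
  have G_meas [measurable]: "(\<lambda>x. G (fst x) (snd x)) \<in> borel_measurable (borel \<Otimes>\<^sub>M borel)"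
    unfolding G_def by measurable
  have "curved_surface_area (hemiellipsoid a b c) (elliptical_region b c)
      = (\<integral>x. indicator {0<..} (q (fst x) (snd x)) * f (fst x) (snd x) \<partial>lborel)"
    unfolding curved_surface_area_def set_lebesgue_integral_def interior_elliptical_region[OF b c]
    by (intro Bochner_Integration.integral_cong)
       (auto simp: q_def f_def hemiellipsoid_area_element split: split_indicator)
  also have "\<dots> = enn2real (\<integral>\<^sup>+x. G (fst x) (snd x) \<partial>lborel)"
  proof (subst integral_eq_nn_integral)
    show "AE x in lborel. 0 \<le> indicator {0<..} (q (fst x) (snd x)) * f (fst x) (snd x)"
      by (intro AE_I2) (auto simp: f_def split: split_indicator)
    show "(\<lambda>x. indicator {0<..} (q (fst x) (snd x)) * f (fst x) (snd x)) \<in> borel_measurable lborel"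
      unfolding lborel_prod[symmetric] by measurable
    show "enn2real (\<integral>\<^sup>+x. ennreal (indicator {0<..} (q (fst x) (snd x)) * f (fst x) (snd x)) \<partial>lborel)
        = enn2real (\<integral>\<^sup>+x. G (fst x) (snd x) \<partial>lborel)"
      by (intro arg_cong[where f = enn2real] nn_integral_cong) (auto simp: G_def split: split_indicator)
  qed
  also have "(\<integral>\<^sup>+x. G (fst x) (snd x) \<partial>lborel) = (\<integral>\<^sup>+y. \<integral>\<^sup>+z. G y z \<partial>lborel \<partial>lborel)"
    unfolding lborel_prod[symmetric] by (subst lborel.nn_integral_fst[symmetric]) simp_all
  also have "\<dots> = (\<integral>\<^sup>+y. \<integral>\<^sup>+w. ennreal \<bar>k * y\<bar> * G y (k * y * w) \<partial>lborel \<partial>lborel)"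
  \<comment> \<open>The substitution has Jacobian |k y| and degenerates at y = 0, which is a null
    set.\<close>
  proof (rule nn_integral_cong_AE, rule eventually_mono[OF AE_lborel_singleton[of 0]])
    fix y :: real assume y: "y \<noteq> 0"
    have [measurable]: "G y \<in> borel_measurable borel"
      using measurable_compose[OF measurable_Pair1' G_meas, of y] by simp
    show "(\<integral>\<^sup>+z. G y z \<partial>lborel) = (\<integral>\<^sup>+w. ennreal \<bar>k * y\<bar> * G y (k * y * w) \<partial>lborel)"
      using y k by (subst nn_integral_real_affine[where c = "k * y" and t = 0])
        (auto simp: nn_integral_cmult)
  qed
  also have "\<dots> = (\<integral>\<^sup>+w. \<integral>\<^sup>+y. ennreal \<bar>k * y\<bar> * G y (k * y * w) \<partial>lborel \<partial>lborel)"
  proof (rule lborel_pair.Fubini'[symmetric])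
    have "(\<lambda>x. (fst x, k * fst x * snd x)) \<in> borel \<Otimes>\<^sub>M borel \<rightarrow>\<^sub>M borel \<Otimes>\<^sub>M borel"
      by measurable
    from measurable_compose[OF this G_meas]
    have [measurable]: "(\<lambda>x. G (fst x) (k * fst x * snd x)) \<in> borel_measurable (borel \<Otimes>\<^sub>M borel)"
      by simp
    have "(\<lambda>x. ennreal \<bar>k * fst x\<bar> * G (fst x) (k * fst x * snd x)) \<in> borel_measurable (borel \<Otimes>\<^sub>M borel)"
      by measurable
    thus "(\<lambda>(y, w). ennreal \<bar>k * y\<bar> * G y (k * y * w)) \<in> borel_measurable (lborel \<Otimes>\<^sub>M lborel)"
      by (simp add: case_prod_unfold)
  qed
  also have "\<dots> = (\<integral>\<^sup>+w. \<integral>\<^sup>+t. ennreal (2 * a\<^sup>2 * b\<^sup>2 * c\<^sup>2 / (B w * (1 - t\<^sup>2) + a\<^sup>2 * t\<^sup>2)\<^sup>2)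
      \<partial>height_measure \<partial>slope_measure)"
  proof -
    have "(\<integral>\<^sup>+y. ennreal \<bar>k * y\<bar> * G y (k * y * w) \<partial>lborel)
        = ennreal (inverse (1 + w\<^sup>2)) *
          (\<integral>\<^sup>+t. ennreal (2 * a\<^sup>2 * b\<^sup>2 * c\<^sup>2 / (B w * (1 - t\<^sup>2) + a\<^sup>2 * t\<^sup>2)\<^sup>2) \<partial>height_measure)" for w
    proof -
      \<comment> \<open>Under z = k y w the quadratic form of the ellipse becomes K y^2, and the
        numerator of the squared gradient becomes M y^2.\<close>
      define K where "K = (b\<^sup>2 + c\<^sup>2 * w\<^sup>2) / b ^ 4"
      define M where "M = a\<^sup>2 * (1 + w\<^sup>2) / b ^ 4"
      have w: "1 + w\<^sup>2 > 0" by (simp add: add_pos_nonneg)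
      have KM: "K > 0" "M > 0"
        using a b w by (auto simp: K_def M_def add_pos_nonneg)
      have q_eq: "q y (k * y * w) = 1 - K * y\<^sup>2" for y
        using b c by (simp add: q_def k_def K_def field_simps eval_nat_numeral)
      have f_eq: "f y (k * y * w) = sqrt (1 + M * y\<^sup>2 / (1 - K * y\<^sup>2))" for y
      proof -
        have "a\<^sup>2 * (y\<^sup>2 / b ^ 4 + (k * y * w)\<^sup>2 / c ^ 4) = M * y\<^sup>2"
          using b c by (simp add: k_def M_def field_simps eval_nat_numeral)
        thus ?thesis by (simp add: f_def q_eq)
      qed
      have dens: "k * (2 * M / (K * (1 - t\<^sup>2) + M * t\<^sup>2)\<^sup>2)
          = inverse (1 + w\<^sup>2) * (2 * a\<^sup>2 * b\<^sup>2 * c\<^sup>2 / (B w * (1 - t\<^sup>2) + a\<^sup>2 * t\<^sup>2)\<^sup>2)" for t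
      proof -
        define d where "d = 1 + w\<^sup>2"
        define D where "D = B w * (1 - t\<^sup>2) + a\<^sup>2 * t\<^sup>2"
        have d: "d > 0" using w by (simp add: d_def)
        have "B w = (b\<^sup>2 + c\<^sup>2 * w\<^sup>2) / (1 + w\<^sup>2)"
          using w by (simp add: B_def sin2_of_slope_def field_simps)
        hence "K = d * B w / b ^ 4" using w by (simp add: K_def d_def)
        hence "K * (1 - t\<^sup>2) + M * t\<^sup>2 = d * D / b ^ 4"
          by (simp add: M_def D_def d_def add_divide_distrib diff_divide_distrib algebra_simps)
        hence "k * (2 * M / (K * (1 - t\<^sup>2) + M * t\<^sup>2)\<^sup>2) = k * (2 * (a\<^sup>2 * d / b ^ 4) / (d * D / b ^ 4)\<^sup>2)"
          by (simp add: M_def d_def)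
        \<comment> \<open>Here t is arbitrary, so \<open>D\<close> may vanish; both sides are then 0
          by the convention on division.\<close>
        also have "\<dots> = inverse d * (2 * a\<^sup>2 * b\<^sup>2 * c\<^sup>2 / D\<^sup>2)"
          using d b by (cases "D = 0") (simp_all add: k_def field_simps eval_nat_numeral)
        finally show ?thesis by (simp add: d_def D_def)
      qed
      have G_eq: "G y (k * y * w) = ennreal (sqrt (1 + M * y\<^sup>2 / (1 - K * y\<^sup>2))) * indicator {y. K * y\<^sup>2 < 1} y" for y
        unfolding G_def q_eq f_eq by (auto split: split_indicator)
      have "(\<integral>\<^sup>+y. ennreal \<bar>k * y\<bar> * G y (k * y * w) \<partial>lborel)
        = (\<integral>\<^sup>+y. ennreal k * (ennreal (\<bar>y\<bar> * sqrt (1 + M * y\<^sup>2 / (1 - K * y\<^sup>2))) * indicator {y. K * y\<^sup>2 < 1} y) \<partial>lborel)"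
        unfolding G_eq using k by (intro nn_integral_cong) (simp add: abs_mult ennreal_mult' mult.assoc)
      also have "\<dots> = ennreal k * (\<integral>\<^sup>+t. ennreal (2 * M / (K * (1 - t\<^sup>2) + M * t\<^sup>2)\<^sup>2) * indicator {0..1} t \<partial>lborel)"
        by (subst nn_integral_cmult) (simp_all add: radial_substitution[OF KM])
      also have "\<dots> = (\<integral>\<^sup>+t. ennreal (k * (2 * M / (K * (1 - t\<^sup>2) + M * t\<^sup>2)\<^sup>2)) * indicator {0..1} t \<partial>lborel)"
        by (subst nn_integral_cmult[symmetric], simp, simp only: ennreal_mult'[OF less_imp_le[OF k]] mult.assoc)
      also have "\<dots> = (\<integral>\<^sup>+t. ennreal (inverse (1 + w\<^sup>2)) *
            (ennreal (2 * a\<^sup>2 * b\<^sup>2 * c\<^sup>2 / (B w * (1 - t\<^sup>2) + a\<^sup>2 * t\<^sup>2)\<^sup>2) * indicator {0..1} t) \<partial>lborel)"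
        using w by (simp only: dens ennreal_mult'[of "inverse (1 + w\<^sup>2)"] inverse_nonnegative_iff_nonnegative less_imp_le mult.assoc)
      also have "\<dots> = ennreal (inverse (1 + w\<^sup>2)) *
          (\<integral>\<^sup>+t. ennreal (2 * a\<^sup>2 * b\<^sup>2 * c\<^sup>2 / (B w * (1 - t\<^sup>2) + a\<^sup>2 * t\<^sup>2)\<^sup>2) \<partial>height_measure)"
        unfolding height_measure_def
        by (subst nn_integral_cmult) (simp_all add: nn_integral_restrict_space)
      finally show ?thesis .
    qed
    moreover have "(\<lambda>w. \<integral>\<^sup>+t. ennreal (2 * a\<^sup>2 * b\<^sup>2 * c\<^sup>2 / (B w * (1 - t\<^sup>2) + a\<^sup>2 * t\<^sup>2)\<^sup>2) \<partial>height_measure)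
        \<in> borel_measurable lborel"
    proof -
      have "(\<lambda>x. ennreal (2 * a\<^sup>2 * b\<^sup>2 * c\<^sup>2 / (B (fst x) * (1 - (snd x)\<^sup>2) + a\<^sup>2 * (snd x)\<^sup>2)\<^sup>2))
        \<in> borel_measurable (slope_measure \<Otimes>\<^sub>M height_measure)"
        unfolding B_def by measurable
      from H.borel_measurable_nn_integral_fst[OF this] show ?thesis
        by (simp cong: measurable_cong_sets)
    qed
    ultimately show ?thesis
      unfolding slope_measure_def by (subst nn_integral_density) simp_all
  qed
  also have "\<dots> = (\<integral>\<^sup>+x. ennreal (2 * a\<^sup>2 * b\<^sup>2 * c\<^sup>2 / (B (fst x) * (1 - (snd x)\<^sup>2) + a\<^sup>2 * (snd x)\<^sup>2)\<^sup>2) \<partial>surface_measure)"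
    unfolding B_def by (subst H.nn_integral_fst[symmetric]) simp_all
  also have "enn2real \<dots> = (\<integral>x. 2 * a\<^sup>2 * b\<^sup>2 * c\<^sup>2 / (B (fst x) * (1 - (snd x)\<^sup>2) + a\<^sup>2 * (snd x)\<^sup>2)\<^sup>2 \<partial>surface_measure)"
    unfolding B_def by (intro integral_eq_nn_integral[symmetric]) auto
  finally show ?thesis .
qed

subsection \<open>The two expansions\<close>

text \<open>The left-hand side is \<open>\<integral>\<^sub>0\<^sup>\<infinity> dt / (P + Q t\<^sup>2)\<^sup>2\<close>: the second integrand is the inversion
  \<open>t \<mapsto> 1 / t\<close> of the part over \<open>{1..}\<close>.\<close>

lemma integral_height_measure_arctan:
  fixes P Q :: real
  assumes P: "P > 0" and Q: "Q > 0"
  shows "(\<integral>t. 1 / (P + Q * t\<^sup>2)\<^sup>2 \<partial>height_measure) + (\<integral>t. t\<^sup>2 / (Q + P * t\<^sup>2)\<^sup>2 \<partial>height_measure)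
       = pi / 4 * P powr (-(3/2)) * Q powr (-(1/2))"
proof -
  define r where "r = sqrt P"
  define s where "s = sqrt Q"
  have rs: "r > 0" "s > 0" "P = r\<^sup>2" "Q = s\<^sup>2" using P Q by (auto simp: r_def s_def)
  \<comment> \<open>\<open>F\<close> and \<open>F'\<close> are antiderivatives of the two
    integrands. For t > 0, \<open>F' t\<close> is pi / (4 r^3 s) - F (1 / t), as the inversion
    suggests.\<close>
  define F where "F = (\<lambda>t. t / (2 * r\<^sup>2 * (r\<^sup>2 + s\<^sup>2 * t\<^sup>2)) + arctan (t * (s / r)) / (2 * r ^ 3 * s))"
  define F' where "F' = (\<lambda>t. - (t / (2 * r\<^sup>2 * (s\<^sup>2 + r\<^sup>2 * t\<^sup>2))) + arctan (t * (r / s)) / (2 * r ^ 3 * s))"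
  have pos: "r\<^sup>2 + s\<^sup>2 * t\<^sup>2 > 0" "s\<^sup>2 + r\<^sup>2 * t\<^sup>2 > 0" for t
    using rs by (simp_all add: add_pos_nonneg)
  have frac: "((\<lambda>t. t / (2 * r\<^sup>2 * (p + q * t\<^sup>2))) has_field_derivative
      (p - q * t\<^sup>2) / (2 * r\<^sup>2 * (p + q * t\<^sup>2)\<^sup>2)) (at t)" if "p + q * t\<^sup>2 > 0" for p q t
    using that rs by (auto intro!: derivative_eq_intros simp: divide_simps power2_eq_square) (simp_all add: algebra_simps)
  have arc: "((\<lambda>t. arctan (t * (v / u)) / (2 * r ^ 3 * s)) has_field_derivative
      u * v / (2 * r ^ 3 * s * (u\<^sup>2 + v\<^sup>2 * t\<^sup>2))) (at t)" if "u > 0" "v > 0" for u v t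
  proof -
    have "u\<^sup>2 + v\<^sup>2 * t\<^sup>2 > 0" using that by (simp add: add_pos_nonneg)
    moreover have eq: "1 + (t * (v / u))\<^sup>2 = (u\<^sup>2 + v\<^sup>2 * t\<^sup>2) / u\<^sup>2" using that by (simp add: field_simps)
    ultimately have "inverse (1 + (t * (v / u))\<^sup>2) * (v / u) = u * v / (u\<^sup>2 + v\<^sup>2 * t\<^sup>2)"
      unfolding eq using that by (simp add: power2_eq_square)
    hence "((\<lambda>t. arctan (t * (v / u))) has_field_derivative u * v / (u\<^sup>2 + v\<^sup>2 * t\<^sup>2)) (at t)"
      using that by (auto intro!: derivative_eq_intros)
    from DERIV_cdivide[OF this, of "2 * r ^ 3 * s"] show ?thesis by (simp add: mult_ac)
  qed
  have F_deriv: "(F has_field_derivative 1 / (P + Q * t\<^sup>2)\<^sup>2) (at t)" for t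
  proof -
    define A where "A = r\<^sup>2 + s\<^sup>2 * t\<^sup>2"
    have A: "A > 0" "s\<^sup>2 * t\<^sup>2 = A - r\<^sup>2" using pos by (simp_all add: A_def)
    have "(r\<^sup>2 - s\<^sup>2 * t\<^sup>2) / (2 * r\<^sup>2 * (r\<^sup>2 + s\<^sup>2 * t\<^sup>2)\<^sup>2) + r * s / (2 * r ^ 3 * s * (r\<^sup>2 + s\<^sup>2 * t\<^sup>2))
        = 1 / (P + Q * t\<^sup>2)\<^sup>2"
      unfolding rs(3,4) unfolding A_def[symmetric] A(2) using rs(1,2) A(1)
      by (simp add: field_simps eval_nat_numeral)
    with DERIV_add[OF frac[OF pos(1)[of t]] arc[OF rs(1,2), of t]] show ?thesis
      unfolding F_def by (simp only:)
  qed
  have F'_deriv: "(F' has_field_derivative t\<^sup>2 / (Q + P * t\<^sup>2)\<^sup>2) (at t)" for t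
  proof -
    define A where "A = s\<^sup>2 + r\<^sup>2 * t\<^sup>2"
    have A: "A > 0" "s\<^sup>2 = A - r\<^sup>2 * t\<^sup>2" using pos by (simp_all add: A_def)
    have "- ((s\<^sup>2 - r\<^sup>2 * t\<^sup>2) / (2 * r\<^sup>2 * (s\<^sup>2 + r\<^sup>2 * t\<^sup>2)\<^sup>2)) + s * r / (2 * r ^ 3 * s * (s\<^sup>2 + r\<^sup>2 * t\<^sup>2))
        = t\<^sup>2 / (Q + P * t\<^sup>2)\<^sup>2"
      unfolding rs(3,4) unfolding A_def[symmetric] unfolding A(2) using rs(1,2) A(1)
      by (simp add: field_simps eval_nat_numeral)
    with DERIV_add[OF DERIV_minus[OF frac[OF pos(2)[of t]]] arc[OF rs(2,1), of t]] show ?thesis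
      unfolding F'_def by (simp only:)
  qed
  have "(\<integral>t. 1 / (P + Q * t\<^sup>2)\<^sup>2 \<partial>height_measure) = F 1 - F 0"
    unfolding integral_height_measure using pos
    by (intro integral_FTC_Icc_real F_deriv) (auto intro!: continuous_intros simp: rs(3,4) less_imp_neq[symmetric])
  moreover have "(\<integral>t. t\<^sup>2 / (Q + P * t\<^sup>2)\<^sup>2 \<partial>height_measure) = F' 1 - F' 0"
    unfolding integral_height_measure using pos
    by (intro integral_FTC_Icc_real F'_deriv) (auto intro!: continuous_intros simp: rs(3,4) less_imp_neq[symmetric])
  moreover have at: "arctan (s / r) + arctan (r / s) = pi / 2"
    using arctan_inverse[of "s / r"] rs by (simp add: divide_pos_pos)
  \<comment> \<open>At t = 1 the rational parts are opposite, and the arctangents of reciprocal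
    arguments add up to pi/2.\<close>
  have "F 1 - F 0 + (F' 1 - F' 0) = pi / 4 / (r ^ 3 * s)"
    unfolding F_def F'_def using rs(1,2)
    by (simp add: add.commute[of "s\<^sup>2"] at flip: add_divide_distrib)
  moreover have "P powr (-(3/2)) = 1 / r ^ 3"
    using rs by (simp add: powr_minus_divide powr_powr flip: powr_numeral)
  moreover have "Q powr (-(1/2)) = 1 / s"
    using rs by (simp add: powr_minus_divide powr_half_sqrt)
  ultimately show ?thesis by simp
qed

text \<open>Extracting b^2 from the denominator turns the integrand into that of
  \<open>appell_F1_double_integral\<close> with j = 0; the b^4 from the square meets the b^2 of the
  numerator.\<close>

lemma surface_area_near_sphere:
  fixes a b c :: real
  assumes "a > b" "b \<ge> c" "c > 0" and X: "\<bar>1 - a\<^sup>2 / b\<^sup>2\<bar> < 1" and y: "\<bar>1 - c\<^sup>2 / b\<^sup>2\<bar> < 1"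
  shows "curved_surface_area (hemiellipsoid a b c) (elliptical_region b c) =
          2 * pi * a\<^sup>2 * c\<^sup>2 / b\<^sup>2 *
          appell_F1 2 (1/2) (1/2) (3/2) (1 - c\<^sup>2 / b\<^sup>2) (1 - a\<^sup>2 / b\<^sup>2)"
proof -
  have pos: "a > 0" "b > 0" "c > 0" using assms by auto
  have 1: "2 * a\<^sup>2 * b\<^sup>2 * c\<^sup>2 / ((b\<^sup>2 - (b\<^sup>2 - c\<^sup>2) * s) * (1 - u) + a\<^sup>2 * u)\<^sup>2
      = 2 * a\<^sup>2 * c\<^sup>2 / b\<^sup>2 * (1 / (1 - (1 - a\<^sup>2 / b\<^sup>2) * u - (1 - c\<^sup>2 / b\<^sup>2) * ((1 - u) * s))\<^sup>2)" for s u
  proof -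
    define E where "E = 1 - (1 - a\<^sup>2 / b\<^sup>2) * u - (1 - c\<^sup>2 / b\<^sup>2) * ((1 - u) * s)"
    have "(b\<^sup>2 - (b\<^sup>2 - c\<^sup>2) * s) * (1 - u) + a\<^sup>2 * u = b\<^sup>2 * E"
      using pos by (simp add: E_def field_simps)
    thus ?thesis unfolding E_def[symmetric] using pos
      \<comment> \<open>As s and u are unrestricted, \<open>E\<close> may be 0; both sides are then
        0.\<close>
      by (cases "E = 0") (simp_all add: field_simps eval_nat_numeral)
  qed
  have "curved_surface_area (hemiellipsoid a b c) (elliptical_region b c)
      = 2 * a\<^sup>2 * c\<^sup>2 / b\<^sup>2 * (pi * appell_F1 2 (1/2) (1/2) (3/2) (1 - a\<^sup>2 / b\<^sup>2) (1 - c\<^sup>2 / b\<^sup>2))"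
    unfolding curved_surface_area_hemiellipsoid[OF pos] 1 integral_mult_right_zero
    using appell_F1_double_integral(2)[OF X y, of 0] by simp
  thus ?thesis by (subst appell_F1_swap) simp
qed

text \<open>With P = B and Q = a^2 - P the denominator is (P + Q t^2)^2. Of the two factors pi in
  the first term, one comes from the elementary t-integral and the other from the integral over all
  slopes.\<close>

lemma surface_area_elongated:
  fixes a b c :: real
  assumes "a > b" "b \<ge> c" "c > 0"
  assumes X1: "\<bar>(b\<^sup>2 - c\<^sup>2) / b\<^sup>2\<bar> < 1" and X2: "\<bar>b\<^sup>2 / (b\<^sup>2 - a\<^sup>2)\<bar> < 1"
    and y: "\<bar>(b\<^sup>2 - c\<^sup>2) / (b\<^sup>2 - a\<^sup>2)\<bar> < 1"
  shows "curved_surface_area (hemiellipsoid a b c) (elliptical_region b c) =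
          pi\<^sup>2 * a\<^sup>2 * c\<^sup>2 / (2 * b * sqrt (a\<^sup>2 - b\<^sup>2)) *
          appell_F1 (1/2) (3/2) (1/2) 1
            ((b\<^sup>2 - c\<^sup>2) / b\<^sup>2) ((b\<^sup>2 - c\<^sup>2) / (b\<^sup>2 - a\<^sup>2))
          - 2 * pi * a\<^sup>2 * b\<^sup>2 * c\<^sup>2 / (3 * (a\<^sup>2 - b\<^sup>2)\<^sup>2) *
          appell_F1 2 (3/2) (1/2) (5/2)
            (b\<^sup>2 / (b\<^sup>2 - a\<^sup>2)) ((b\<^sup>2 - c\<^sup>2) / (b\<^sup>2 - a\<^sup>2))"
    (is "_ = _ * ?F - _ * ?G")
proof -
  interpret pair_sigma_finite slope_measure height_measure by (rule pair_sigma_finite_surface)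
  have pos: "a > 0" "b > 0" "c > 0" using assms by auto
  define e where "e = a\<^sup>2 - b\<^sup>2"
  have e: "e > 0" using assms pos by (simp add: e_def power_strict_mono)
  define x where "x = (b\<^sup>2 - c\<^sup>2) / b\<^sup>2"
  define X where "X = b\<^sup>2 / (b\<^sup>2 - a\<^sup>2)"
  define Y where "Y = (b\<^sup>2 - c\<^sup>2) / (b\<^sup>2 - a\<^sup>2)"
  have XY: "e * X = - b\<^sup>2" "e * Y = - (b\<^sup>2 - c\<^sup>2)" "b\<^sup>2 * x = b\<^sup>2 - c\<^sup>2"
  proof -
    have "b\<^sup>2 - a\<^sup>2 = - e" by (simp add: e_def)
    thus "e * X = - b\<^sup>2" "e * Y = - (b\<^sup>2 - c\<^sup>2)" using e by (simp_all add: X_def Y_def)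
    show "b\<^sup>2 * x = b\<^sup>2 - c\<^sup>2" using pos by (simp add: x_def)
  qed
  define P where "P = (\<lambda>w. b\<^sup>2 - (b\<^sup>2 - c\<^sup>2) * sin2_of_slope w)"
  define Q where "Q = (\<lambda>w. a\<^sup>2 - P w)"
  have P_eq: "P w = b\<^sup>2 * (1 - x * sin2_of_slope w)" for w
    unfolding P_def XY(3)[symmetric] by (simp add: algebra_simps)
  have Q_eq: "Q w = e * (1 - Y * sin2_of_slope w)" for w
  proof -
    have "e * (1 - Y * sin2_of_slope w) = e - (e * Y) * sin2_of_slope w" by (simp add: algebra_simps)
    thus ?thesis unfolding XY by (simp add: Q_def P_def e_def algebra_simps)
  qed
  have P_ge: "P w \<ge> c\<^sup>2" for w
  proof -
    have "(b\<^sup>2 - c\<^sup>2) * sin2_of_slope w \<le> b\<^sup>2 - c\<^sup>2"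
      using assms by (intro mult_left_le sin2_of_slope_bounds) (simp add: power_mono)
    thus ?thesis by (simp add: P_def)
  qed
  have Q_ge: "Q w \<ge> e" for w
  proof -
    have "(b\<^sup>2 - c\<^sup>2) * sin2_of_slope w \<ge> 0"
      using assms by (intro mult_nonneg_nonneg sin2_of_slope_bounds) (simp add: power_mono)
    thus ?thesis by (simp add: Q_def P_def e_def)
  qed
  have P_pos: "P w > 0" for w using P_ge[of w] pos by (meson less_le_trans zero_less_power)
  have Q_pos: "Q w > 0" for w using Q_ge[of w] e by linarith
  have [measurable]: "P \<in> borel_measurable borel" "Q \<in> borel_measurable borel"
    unfolding P_def Q_def by measurable
  define h where "h = (\<lambda>z. 1 / (P (fst z) + Q (fst z) * (snd z)\<^sup>2)\<^sup>2)"
  define h' where "h' = (\<lambda>z. (snd z)\<^sup>2 / (Q (fst z) + P (fst z) * (snd z)\<^sup>2)\<^sup>2)"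
  have h_int: "integrable surface_measure h"
  proof (rule finite_measure.integrable_const_bound[OF finite_surface_measure, of _ "1 / (c\<^sup>2)\<^sup>2"])
    have "norm (h z) \<le> 1 / (c\<^sup>2)\<^sup>2" for z
    proof -
      have "P (fst z) + Q (fst z) * (snd z)\<^sup>2 \<ge> c\<^sup>2"
        using P_ge[of "fst z"] Q_pos[of "fst z"] by (simp add: add_increasing2)
      hence "1 / (P (fst z) + Q (fst z) * (snd z)\<^sup>2)\<^sup>2 \<le> 1 / (c\<^sup>2)\<^sup>2"
        using pos P_pos[of "fst z"] Q_pos[of "fst z"]
        by (intro divide_left_mono power_mono mult_pos_pos zero_less_power add_pos_nonneg) auto
      thus ?thesis by (simp add: h_def)
    qed
    thus "AE z in surface_measure. norm (h z) \<le> 1 / (c\<^sup>2)\<^sup>2" by (intro AE_I2)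
    show "h \<in> borel_measurable surface_measure" unfolding h_def by measurable
  qed
  \<comment> \<open>Extracting e = a^2 - b^2 from the inverted denominator exhibits the integrand of
    \<open>appell_F1_double_integral\<close> with j = 1.\<close>
  have h'_eq: "h' = (\<lambda>z. 1 / e\<^sup>2 * (snd z ^ (2 * 1)
      / (1 - X * (snd z)\<^sup>2 - Y * ((1 - (snd z)\<^sup>2) * sin2_of_slope (fst z)))\<^sup>2))"
  proof
    fix z :: "real \<times> real"
    let ?E = "1 - X * (snd z)\<^sup>2 - Y * ((1 - (snd z)\<^sup>2) * sin2_of_slope (fst z))"
    have "e * ?E = e - (e * X) * (snd z)\<^sup>2 - (e * Y) * ((1 - (snd z)\<^sup>2) * sin2_of_slope (fst z))"
      by (simp add: algebra_simps)
    also have "\<dots> = Q (fst z) + P (fst z) * (snd z)\<^sup>2"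
      unfolding XY by (simp add: Q_def P_def e_def algebra_simps)
    finally have eq: "Q (fst z) + P (fst z) * (snd z)\<^sup>2 = e * ?E" by (rule sym)
    show "h' z = 1 / e\<^sup>2 * (snd z ^ (2 * 1) / ?E\<^sup>2)"
      unfolding h'_def eq by (simp add: power_mult_distrib)
  qed
  note F1 = appell_F1_double_integral[OF X2[folded X_def] y[folded Y_def], of 1]
  have h'_int: "integrable surface_measure h'"
    unfolding h'_eq by (intro integrable_mult_right F1)
  have h'_integral: "(\<integral>z. h' z \<partial>surface_measure) = pi / (3 * e\<^sup>2) * ?G"
    unfolding h'_eq integral_mult_right_zero F1(2) by (simp add: X_def Y_def)
  \<comment> \<open>Only the sum of the two t-integrals is a pure product of powers of P and Q.
    Extracting b^2 from P and e from Q gives the constants b^(-3) and e^(-1/2).\<close>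
  have inner: "(\<integral>t. h (w, t) \<partial>height_measure) + (\<integral>t. h' (w, t) \<partial>height_measure)
      = pi / (4 * b ^ 3 * sqrt e) * ((1 - x * sin2_of_slope w) powr (-(3/2)) * (1 - Y * sin2_of_slope w) powr (-(1/2)))" for w
  proof -
    have "(b\<^sup>2) powr (-(3/2)) = 1 / b ^ 3"
      using pos by (simp add: powr_minus_divide powr_powr flip: powr_numeral)
    moreover have "e powr (-(1/2)) = 1 / sqrt e"
      using e by (simp add: powr_minus_divide powr_half_sqrt)
    moreover have "1 - x * sin2_of_slope w \<ge> 0" "1 - Y * sin2_of_slope w \<ge> 0"
      using P_pos[of w] Q_pos[of w] pos e unfolding P_eq Q_eq by (auto simp: zero_less_mult_iff)
    ultimately have "P w powr (-(3/2)) = 1 / b ^ 3 * (1 - x * sin2_of_slope w) powr (-(3/2))"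
      "Q w powr (-(1/2)) = 1 / sqrt e * (1 - Y * sin2_of_slope w) powr (-(1/2))"
      using pos e unfolding P_eq Q_eq by (simp_all add: powr_mult)
    thus ?thesis
      using integral_height_measure_arctan[OF P_pos Q_pos, of w w] by (simp add: h_def h'_def)
  qed
  have "(\<integral>z. h z \<partial>surface_measure) + (\<integral>z. h' z \<partial>surface_measure)
      = (\<integral>w. (\<integral>t. h (w, t) \<partial>height_measure) + (\<integral>t. h' (w, t) \<partial>height_measure) \<partial>slope_measure)"
    using h_int h'_int
    by (simp add: integral_fst'[symmetric] integrable_fst' Bochner_Integration.integral_add)
  also have "\<dots> = pi / (4 * b ^ 3 * sqrt e) * (pi * ?F)"
    unfolding inner integral_mult_right_zero
    using appell_F1_single_integral[OF X1 y, of "3/2" "1/2"] by (simp add: x_def Y_def)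
  finally have h_integral: "(\<integral>z. h z \<partial>surface_measure) = pi\<^sup>2 / (4 * b ^ 3 * sqrt e) * ?F - pi / (3 * e\<^sup>2) * ?G"
    unfolding h'_integral by (simp add: power2_eq_square)
  have "curved_surface_area (hemiellipsoid a b c) (elliptical_region b c)
      = (\<integral>z. 2 * a\<^sup>2 * b\<^sup>2 * c\<^sup>2 * h z \<partial>surface_measure)"
    unfolding curved_surface_area_hemiellipsoid[OF pos]
    by (intro Bochner_Integration.integral_cong refl) (simp add: h_def Q_def P_def algebra_simps)
  also have "\<dots> = 2 * a\<^sup>2 * b\<^sup>2 * c\<^sup>2 * (pi\<^sup>2 / (4 * b ^ 3 * sqrt e) * ?F - pi / (3 * e\<^sup>2) * ?G)"
    by (simp only: integral_mult_right_zero h_integral)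
  also have "\<dots> = pi\<^sup>2 * a\<^sup>2 * c\<^sup>2 / (2 * b * sqrt e) * ?F - 2 * pi * a\<^sup>2 * b\<^sup>2 * c\<^sup>2 / (3 * e\<^sup>2) * ?G"
  proof -
    have lin: "k * (u * F - v * G) = (k * u) * F - (k * v) * G" for k u v F G :: real
      by (simp add: algebra_simps)
    have eq: "2 * a\<^sup>2 * b\<^sup>2 * c\<^sup>2 * (pi\<^sup>2 / (4 * b ^ 3 * sqrt e)) = pi\<^sup>2 * a\<^sup>2 * c\<^sup>2 / (2 * b * sqrt e)"
      using pos e by (simp add: divide_simps) (simp add: eval_nat_numeral)
    show ?thesis unfolding lin eq by (simp add: mult_ac)
  qed
  finally show ?thesis unfolding e_def .
qed

section \<open>Convergence conditions and the two cases\<close>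

theorem theorem6:
  fixes a b c :: real
  assumes "a \<ge> b" and "b \<ge> c" and "c > 0"
  shows
    "(a > b \<and> \<bar>1 - a\<^sup>2 / b\<^sup>2\<bar> < 1 \<longrightarrow>
        \<bar>1 - c\<^sup>2 / b\<^sup>2\<bar> < 1 \<and>
        curved_surface_area (hemiellipsoid a b c) (elliptical_region b c) =
          2 * pi * a\<^sup>2 * c\<^sup>2 / b\<^sup>2 *
          appell_F1 2 (1/2) (1/2) (3/2) (1 - c\<^sup>2 / b\<^sup>2) (1 - a\<^sup>2 / b\<^sup>2))
     \<and>
     (a > b \<and> \<bar>1 - a\<^sup>2 / b\<^sup>2\<bar> > 1 \<longrightarrow>
        \<bar>1 - c\<^sup>2 / b\<^sup>2\<bar> < 1 \<and>
        \<bar>b\<^sup>2 / (b\<^sup>2 - a\<^sup>2)\<bar> < 1 \<and>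
        \<bar>(b\<^sup>2 - c\<^sup>2) / (b\<^sup>2 - a\<^sup>2)\<bar> < 1 \<and>
        curved_surface_area (hemiellipsoid a b c) (elliptical_region b c) =
          pi\<^sup>2 * a\<^sup>2 * c\<^sup>2 / (2 * b * sqrt (a\<^sup>2 - b\<^sup>2)) *
          appell_F1 (1/2) (3/2) (1/2) 1
            ((b\<^sup>2 - c\<^sup>2) / b\<^sup>2) ((b\<^sup>2 - c\<^sup>2) / (b\<^sup>2 - a\<^sup>2))
          - 2 * pi * a\<^sup>2 * b\<^sup>2 * c\<^sup>2 / (3 * (a\<^sup>2 - b\<^sup>2)\<^sup>2) *
          appell_F1 2 (3/2) (1/2) (5/2)
            (b\<^sup>2 / (b\<^sup>2 - a\<^sup>2)) ((b\<^sup>2 - c\<^sup>2) / (b\<^sup>2 - a\<^sup>2)))"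
proof (intro conjI impI; elim conjE)
  have sq: "0 < c\<^sup>2" "c\<^sup>2 \<le> b\<^sup>2" "0 < b\<^sup>2"
    using assms by (auto simp: power_mono)
  have c_lt: "\<bar>1 - c\<^sup>2 / b\<^sup>2\<bar> < 1"
    using sq by (simp add: abs_less_iff field_simps)
  have x_lt: "\<bar>(b\<^sup>2 - c\<^sup>2) / b\<^sup>2\<bar> < 1"
    using sq by (simp add: abs_less_iff field_simps)
  {
    assume "a > b" "\<bar>1 - a\<^sup>2 / b\<^sup>2\<bar> < 1"
    show "\<bar>1 - c\<^sup>2 / b\<^sup>2\<bar> < 1" by (rule c_lt)
    show "curved_surface_area (hemiellipsoid a b c) (elliptical_region b c) =
          2 * pi * a\<^sup>2 * c\<^sup>2 / b\<^sup>2 *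
          appell_F1 2 (1/2) (1/2) (3/2) (1 - c\<^sup>2 / b\<^sup>2) (1 - a\<^sup>2 / b\<^sup>2)"
      using surface_area_near_sphere \<open>a > b\<close> assms \<open>\<bar>1 - a\<^sup>2 / b\<^sup>2\<bar> < 1\<close> c_lt by blast
  next
    assume ab: "a > b" and far: "\<bar>1 - a\<^sup>2 / b\<^sup>2\<bar> > 1"
    have "b\<^sup>2 < a\<^sup>2" using ab assms by (simp add: power_strict_mono)
    \<comment> \<open>Since a^2 / b^2 > 1, the absolute value can exceed 1 only through a^2 / b^2 -
      1 > 1. The bound b^2 < a^2 - b^2 then controls both arguments with denominator b^2 -
      a^2.\<close>
    hence gt: "a\<^sup>2 - b\<^sup>2 > b\<^sup>2" using far sq by (simp add: abs_if field_simps split: if_splits)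
    have abs_eq: "\<bar>b\<^sup>2 - a\<^sup>2\<bar> = a\<^sup>2 - b\<^sup>2" using gt sq by linarith
    show "\<bar>1 - c\<^sup>2 / b\<^sup>2\<bar> < 1" by (rule c_lt)
    have "a\<^sup>2 - b\<^sup>2 > 0" using gt sq by linarith
    note frac_lt = divide_less_eq_1_pos[OF this]
    show X: "\<bar>b\<^sup>2 / (b\<^sup>2 - a\<^sup>2)\<bar> < 1" using gt sq by (simp add: abs_divide abs_eq frac_lt)
    show Y: "\<bar>(b\<^sup>2 - c\<^sup>2) / (b\<^sup>2 - a\<^sup>2)\<bar> < 1"
      using sq by (simp add: abs_divide abs_eq frac_lt) (use gt sq in linarith)
    show "curved_surface_area (hemiellipsoid a b c) (elliptical_region b c) =
          pi\<^sup>2 * a\<^sup>2 * c\<^sup>2 / (2 * b * sqrt (a\<^sup>2 - b\<^sup>2)) *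
          appell_F1 (1/2) (3/2) (1/2) 1
            ((b\<^sup>2 - c\<^sup>2) / b\<^sup>2) ((b\<^sup>2 - c\<^sup>2) / (b\<^sup>2 - a\<^sup>2))
          - 2 * pi * a\<^sup>2 * b\<^sup>2 * c\<^sup>2 / (3 * (a\<^sup>2 - b\<^sup>2)\<^sup>2) *
          appell_F1 2 (3/2) (1/2) (5/2)
            (b\<^sup>2 / (b\<^sup>2 - a\<^sup>2)) ((b\<^sup>2 - c\<^sup>2) / (b\<^sup>2 - a\<^sup>2))"
      using surface_area_elongated[OF ab assms(2,3) x_lt X Y] .
  }
qed

end
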